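(* There is a (deterministic) algorithm for Partial Grundy Coloring that runs in time $2^{\mathcal{O}(k^2(d+\log k))}\cdot n^{\mathcal{O}(1)}$, where $n$ is the number of vertices and $d$ is the degeneracy of the input graph.
   Context: The degeneracy of a graph is the least $d$ such that every subgraph has a vertex of degree at most $d$. Partial Grundy Coloring: given a graph $G$ and a positive integer $k$, decide whether $G$ admits a partial Grundy coloring using at least $k$ colors, i.e., for some $k'\ge k$ a proper coloring $c:V(G)\to[k']$ such that for every $i\in[k']$ there is a vertex $v$ with $c(v)=i$ which, for every $j\in[i-1]$, has a neighbor $u$ with $c(u)=j$. *)

theory Defs
  imports Complex_Main "Graph_Theory.Pair_Digraph" "Graph_Theory.Digraph_Component"
begin

section \<open>Degeneracy and partial Grundy colorings\<close>

text \<open>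
  Finite simple graphs are the \<^locale>\<open>pair_graph\<close>s of the library: finite, symmetric,
  loop-free sets of arcs. The degree of a vertex is its out-degree.
  The null graph has no vertex at all, so subgraphs are required to be nonempty.
\<close>

definition degenerate :: "'a pair_pre_digraph \<Rightarrow> nat \<Rightarrow> bool" where
  "degenerate G d \<longleftrightarrow>
     (\<forall>H :: 'a pair_pre_digraph.
        pair_graph H \<longrightarrow> subgraph (with_proj H) (with_proj G) \<longrightarrow> pverts H \<noteq> {} \<longrightarrow>
        (\<exists>v\<in>pverts H. out_degree (with_proj H) v \<le> d))"

definition degeneracy :: "'a pair_pre_digraph \<Rightarrow> nat" where
  "degeneracy G = (LEAST d. degenerate G d)"

lemma degenerate_card_parcs:
  assumes "pair_graph G"
  shows "degenerate G (card (parcs G))"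
  unfolding degenerate_def
proof (intro allI impI)
  fix H :: "'a pair_pre_digraph"
  assume H: "subgraph (with_proj H) (with_proj G)" "pverts H \<noteq> {}"
  then obtain v where v: "v \<in> pverts H" by blast
  interpret pair_graph G by (fact assms)
  have "out_arcs (with_proj H) v \<subseteq> parcs G"
    using H(1) by (auto simp: subgraph_def out_arcs_def)
  then have "out_degree (with_proj H) v \<le> card (parcs G)"
    unfolding out_degree_def by (intro card_mono pair_finite_arcs)
  with v show "\<exists>v\<in>pverts H. out_degree (with_proj H) v \<le> card (parcs G)" by blast
qed

lemma degenerate_degeneracy: "pair_graph G \<Longrightarrow> degenerate G (degeneracy G)"
  unfolding degeneracy_def by (rule LeastI) (rule degenerate_card_parcs)

definition proper_coloring :: "'a pair_pre_digraph \<Rightarrow> nat \<Rightarrow> ('a \<Rightarrow> nat) \<Rightarrow> bool" where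
  "proper_coloring G k c \<longleftrightarrow>
     (\<forall>v\<in>pverts G. c v \<in> {1..k}) \<and> (\<forall>(u, v)\<in>parcs G. c u \<noteq> c v)"

definition partial_grundy_coloring :: "'a pair_pre_digraph \<Rightarrow> nat \<Rightarrow> ('a \<Rightarrow> nat) \<Rightarrow> bool" where
  "partial_grundy_coloring G k c \<longleftrightarrow>
     proper_coloring G k c \<and>
     (\<forall>i\<in>{1..k}. \<exists>v\<in>pverts G. c v = i \<and>
        (\<forall>j\<in>{1..i - 1}. \<exists>u\<in>pverts G. (v, u) \<in> parcs G \<and> c u = j))"

definition has_partial_grundy_coloring :: "'a pair_pre_digraph \<Rightarrow> nat \<Rightarrow> bool" where
  "has_partial_grundy_coloring G k \<longleftrightarrow> (\<exists>k'\<ge>k. \<exists>c. partial_grundy_coloring G k' c)"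


section \<open>Deterministic random access machine programs\<close>

text \<open>
  The machine model is the random access machine with structured control flow. The memory
  consists of named zero-based arrays of natural numbers, of which a program can mention only
  finitely many; a scalar register is cell 0 of an array. Every expression node and every
  command costs one step. The only arithmetic is addition and truncated subtraction, so
  the bit length of numbers grows by at most one per step; hence the unit-cost measure is
  polynomially related to Turing machine time (with multiplication as a unit-cost
  operation this would fail).
\<close>

type_synonym memory = "string \<Rightarrow> nat \<Rightarrow> nat"

datatype expr =
    Const nat
  | Load string expr
  | Add expr expr
  | Sub expr expr

primrec eval_expr :: "expr \<Rightarrow> memory \<Rightarrow> nat" where
  "eval_expr (Const a) m = a"
| "eval_expr (Load x e) m = m x (eval_expr e m)"
| "eval_expr (Add e f) m = eval_expr e m + eval_expr f m"
| "eval_expr (Sub e f) m = eval_expr e m - eval_expr f m"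

primrec expr_cost :: "expr \<Rightarrow> nat" where
  "expr_cost (Const a) = 1"
| "expr_cost (Load x e) = 1 + expr_cost e"
| "expr_cost (Add e f) = 1 + expr_cost e + expr_cost f"
| "expr_cost (Sub e f) = 1 + expr_cost e + expr_cost f"

datatype program =
    Skip
  | Store string expr expr
  | Seq program program
  | Cond expr program program
  | While expr program

text \<open>
  \<open>runs p m t m'\<close>: started in memory \<open>m\<close>, program \<open>p\<close> halts after exactly \<open>t\<close> steps
  in memory \<open>m'\<close>. A test succeeds if its value is nonzero.
\<close>

inductive runs :: "program \<Rightarrow> memory \<Rightarrow> nat \<Rightarrow> memory \<Rightarrow> bool" where
  Skip: "runs Skip m 1 m"
| Store: "runs (Store x i e) m (1 + expr_cost i + expr_cost e)
            (m(x := (m x)(eval_expr i m := eval_expr e m)))"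
| Seq: "runs p m s m' \<Longrightarrow> runs q m' t m'' \<Longrightarrow> runs (Seq p q) m (1 + s + t) m''"
| CondTrue: "eval_expr b m \<noteq> 0 \<Longrightarrow> runs p m t m' \<Longrightarrow>
            runs (Cond b p q) m (1 + expr_cost b + t) m'"
| CondFalse: "eval_expr b m = 0 \<Longrightarrow> runs q m t m' \<Longrightarrow>
            runs (Cond b p q) m (1 + expr_cost b + t) m'"
| WhileTrue: "eval_expr b m \<noteq> 0 \<Longrightarrow> runs p m s m' \<Longrightarrow> runs (While b p) m' t m'' \<Longrightarrow>
            runs (While b p) m (1 + expr_cost b + s + t) m''"
| WhileFalse: "eval_expr b m = 0 \<Longrightarrow> runs (While b p) m (1 + expr_cost b) m"

inductive_cases runs_SkipE: "runs Skip m t m'"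
  and runs_StoreE: "runs (Store x i e) m t m'"
  and runs_SeqE: "runs (Seq p q) m t m'"
  and runs_CondE: "runs (Cond b p q) m t m'"
  and runs_WhileE: "runs (While b p) m t m'"

lemma runs_deterministic:
  "runs p m t m' \<Longrightarrow> runs p m s m'' \<Longrightarrow> t = s \<and> m' = m''"
proof (induction arbitrary: s m'' rule: runs.induct)
  case (Skip m)
  then show ?case by (auto elim: runs_SkipE)
next
  case (Store x i e m)
  then show ?case by (auto elim: runs_StoreE)
next
  case (Seq p m s1 m1 q t1 m2)
  from Seq.prems obtain s' t' n where "s = 1 + s' + t'" "runs p m s' n" "runs q n t' m''"
    by (rule_tac runs_SeqE) auto
  with Seq.IH show ?case by metis
next
  case (CondTrue b m p t m' q)
  from CondTrue.prems CondTrue.hyps obtain t' where "s = 1 + expr_cost b + t'" "runs p m t' m''"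
    by (rule_tac runs_CondE) auto
  with CondTrue.IH show ?case by metis
next
  case (CondFalse b m q t m' p)
  from CondFalse.prems CondFalse.hyps obtain t' where "s = 1 + expr_cost b + t'" "runs q m t' m''"
    by (rule_tac runs_CondE) auto
  with CondFalse.IH show ?case by metis
next
  case (WhileTrue b m p s1 m1 t1 m2)
  from WhileTrue.prems WhileTrue.hyps(1) obtain s' t' n
    where "s = 1 + expr_cost b + s' + t'" "runs p m s' n" "runs (While b p) n t' m''"
    by (rule_tac runs_WhileE) auto
  with WhileTrue.IH show ?case by metis
next
  case (WhileFalse b m p)
  from WhileFalse.prems WhileFalse.hyps show ?case by (rule_tac runs_WhileE) auto
qed

text \<open>
  Input encoding: the number \<open>n\<close> of vertices, the parameter \<open>k\<close> and the row-major adjacency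
  matrix of a graph on \<open>{0..<n}\<close>; all other cells are zero.
\<close>

definition pgc_input :: "nat pair_pre_digraph \<Rightarrow> nat \<Rightarrow> nat \<Rightarrow> memory" where
  "pgc_input G n k =
     (\<lambda>_ _. 0)
       (''n'' := (\<lambda>_. 0)(0 := n),
        ''k'' := (\<lambda>_. 0)(0 := k),
        ''adj'' := (\<lambda>i. if (i div n, i mod n) \<in> parcs G then 1 else 0))"

end

theory Submission
  imports Defs
begin

text \<open>
  A partial Grundy coloring with at least \<open>k\<close> colors exists iff some properly colored vertex set
  contains, for every color \<open>i \<le> k\<close>, a vertex with neighbors of all smaller colors: the remaining
  vertices can be colored greedily. Such a witness needs at most \<open>k\<^sup>2\<close> vertices. Orient the
  graph along a degeneracy ordering; the witness \<open>W\<close> together with its out-neighbors is a set \<open>S\<close> of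
  at most \<open>s = k\<^sup>2 (d + 1)\<close> vertices. For some modulus \<open>q = O(s\<^sup>2 log n)\<close> the
  residues of \<open>S\<close> are distinct, since the least common multiple of \<open>1, \<dots>, 2 m\<close> exceeds \<open>2 ^ m\<close>.
  Guess the residues of the \<open>k\<^sup>2\<close> witness vertices, color every vertex by its residue (or not
  at all), and discard each vertex with an out-neighbor of its own color. What is left is properly
  colored, and under the right guess it contains \<open>W\<close>. The number of guesses is \<open>q\<close> to the power
  \<open>k\<^sup>2\<close>, where the factor \<open>(log n)\<close> to the power \<open>k\<^sup>2\<close> is absorbed by
  \<open>x ^ r \<le> r ^ r * exp x\<close>.

  The machine works on a stack: a piece of code is a program depending on the stack depth, which
  leaves its value on top of the stack. All loops are bounded by a common number \<open>M\<close>, so that every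
  piece of code takes at most \<open>M ^ j\<close> steps for a constant \<open>j\<close>; the constants are far from tight.
\<close>

section \<open>Residues and extension of colorings\<close>

lemma mult_binomial_dvd_common_multiple:
  fixes D m k :: nat
  assumes "\<And>i. 1 \<le> i \<Longrightarrow> i \<le> m \<Longrightarrow> i dvd D" and "1 \<le> k" and "k \<le> m"
  shows "k * (m choose k) dvd D"
proof -
  \<comment> \<open>Integrality of a quotient replaces divisibility because the induction subtracts:
    the reciprocals of \<open>k * (m choose k)\<close> form the Leibniz harmonic triangle, in which
    each entry is a difference of two entries of the preceding column.\<close>
  have "real D / real (k * (m choose k)) \<in> \<int>"
    using assms(2,3,1)
  proof (induction k arbitrary: m rule: nat_induct_at_least)
    case base
    then obtain c where "D = m * c" by (meson dvdE le_refl)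
    then show ?case using base by simp
  next
    case (Suc k)
    let ?X = "(m - 1) choose k" and ?Y = "m choose k"
    have X: "real D / real (k * ?X) \<in> \<int>"
      by (rule Suc.IH) (use Suc.prems in auto)
    have Y: "real D / real (k * ?Y) \<in> \<int>"
      by (rule Suc.IH) (use Suc.prems in auto)
    have pos: "?X > 0" "?Y > 0" "k > 0" "m > k" using Suc by auto
    have "Suc k * (m choose Suc k) = m * ?X"
      using pos Suc_times_binomial[of k "m - 1"] by (cases m) auto
    moreover have "(m - k) * ?Y = m * ?X" by (rule binomial_absorb_comp)
    then have "(real m - real k) * real ?Y = real m * real ?X"
      using pos by (metis less_imp_le_nat of_nat_diff of_nat_mult)
    then have "real D / (real m * real ?X) = real D / (real k * real ?X) - real D / (real k * real ?Y)"
      using pos by (simp add: divide_simps) algebra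
    ultimately have "real D / real (Suc k * (m choose Suc k)) =
        real D / real (k * ?X) - real D / real (k * ?Y)"
      by (metis of_nat_mult)
    with X Y show ?case by (metis Ints_diff)
  qed
  then obtain z :: int where z: "real D / real (k * (m choose k)) = of_int z" by (rule Ints_cases)
  have "k * (m choose k) > 0" using assms by simp
  with z have "real D = of_int z * real (k * (m choose k))" by (simp add: field_simps)
  then have "int D = z * int (k * (m choose k))"
    by (metis of_int_eq_iff of_int_mult of_int_of_nat_eq)
  then show ?thesis by (metis dvd_triv_right int_dvd_int_iff)
qed

text \<open>Otherwise \<open>m * ((2 * m) choose m)\<close> would divide \<open>D\<close>, but the
  central binomial coefficient makes it at least \<open>4 ^ m / 2\<close>, hence at least
  \<open>2 ^ m\<close>.\<close>

lemma exists_small_nondivisor: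
  fixes D m :: nat
  assumes "D > 0" and "D < 2 ^ m" and "m > 0"
  shows "\<exists>q\<in>{1..2 * m}. \<not> q dvd D"
proof (rule ccontr)
  assume "\<not> ?thesis"
  then have "m * ((2 * m) choose m) dvd D"
    using assms by (intro mult_binomial_dvd_common_multiple) auto
  then have "real m * real ((2 * m) choose m) \<le> real D"
    using assms by (metis dvd_imp_le of_nat_le_iff of_nat_mult)
  moreover have "4 ^ m / 2 \<le> real m * real ((2 * m) choose m)"
    using central_binomial_lower_bound[of m] assms by (simp add: field_simps)
  moreover have "(2::real) ^ m \<le> 4 ^ m / 2"
  proof -
    have "(2::real) ^ m * 2 \<le> 2 ^ m * 2 ^ m"
      using assms(3) by (intro mult_left_mono) (auto simp: self_le_power)
    also have "\<dots> = 4 ^ m" by (simp flip: power_mult_distrib)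
    finally show ?thesis by simp
  qed
  moreover have "real D < 2 ^ m" using assms(2) by (metis of_nat_less_iff of_nat_power of_nat_numeral)
  ultimately show False by linarith
qed

lemma exists_injective_modulus:
  fixes S :: "nat set"
  assumes S: "S \<subseteq> {..<n}" and card: "card S \<le> s" and n: "n \<le> 2 ^ L"
  shows "\<exists>q\<in>{1..2 * (L * (s * s) + 1)}. inj_on (\<lambda>x. x mod q) S"
proof -
  have fin: "finite S" using S finite_subset by blast
  define Z where "Z = {(x, y). x \<in> S \<and> y \<in> S \<and> x < y}"
  have Z: "Z \<subseteq> S \<times> S" by (auto simp: Z_def)
  then have finZ: "finite Z" using fin finite_subset by blast
  \<comment> \<open>A number that does not divide the product of all differences divides no single
    difference, so it separates the residues of all pairs.\<close>
  define D where "D = (\<Prod>(x, y)\<in>Z. y - x)"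
  have "D > 0" unfolding D_def by (rule prod_pos) (auto simp: Z_def)
  have "D \<le> (\<Prod>z\<in>Z. 2 ^ L)" unfolding D_def
  proof (rule prod_mono, clarify)
    fix x y assume "(x, y) \<in> Z"
    then have "y - x \<le> n" using S by (auto simp: Z_def)
    then show "0 \<le> y - x \<and> y - x \<le> 2 ^ L" using n by simp
  qed
  also have "\<dots> = 2 ^ (L * card Z)" by (simp add: power_mult)
  also have "\<dots> \<le> 2 ^ (L * (s * s))"
  proof -
    have "card Z \<le> card S * card S"
      using card_mono[OF _ Z] fin by (simp add: card_cartesian_product)
    also have "\<dots> \<le> s * s" using card by (intro mult_mono) auto
    finally show ?thesis by (intro power_increasing) auto
  qed
  \<comment> \<open>The extra factor 2 makes the bound strict and the exponent positive even if
    \<open>L * (s * s)\<close> vanishes.\<close>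
  also have "\<dots> < 2 ^ (L * (s * s) + 1)" by simp
  finally have "D < 2 ^ (L * (s * s) + 1)" .
  then obtain q where q: "q \<in> {1..2 * (L * (s * s) + 1)}" "\<not> q dvd D"
    using exists_small_nondivisor \<open>D > 0\<close> by (metis add_gr_0 zero_less_one)
  have "x mod q \<noteq> y mod q" if "x \<in> S" "y \<in> S" "x < y" for x y
  proof
    assume "x mod q = y mod q"
    then have "q dvd y - x" using that mod_eq_dvd_iff_nat[of x y q] by simp
    moreover have "y - x dvd D" unfolding D_def
      using that finZ dvd_prodI[of Z "(x, y)" "\<lambda>(x, y). y - x"] by (auto simp: Z_def)
    ultimately show False using q(2) dvd_trans by blast
  qed
  then have "inj_on (\<lambda>x. x mod q) S"
    by (intro inj_onI) (metis nat_neq_iff)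
  with q(1) show ?thesis by blast
qed

text \<open>Lets one loop over \<open>N\<close> run through all simultaneous guesses of
  \<open>r\<close> residues.\<close>

lemma digits_exist:
  fixes e :: "nat \<Rightarrow> nat"
  assumes "\<And>p. p < r \<Longrightarrow> e p < q"
  shows "\<exists>N<q ^ r. \<forall>p<r. N div q ^ p mod q = e p"
  using assms
proof (induction r arbitrary: e)
  case 0
  then show ?case by simp
next
  case (Suc r)
  obtain N where N: "N < q ^ r" "\<And>p. p < r \<Longrightarrow> N div q ^ p mod q = e (Suc p)"
    using Suc.IH[of "\<lambda>p. e (Suc p)"] Suc.prems by auto
  have e0: "e 0 < q" using Suc.prems by simp
  have "Suc N * q \<le> q ^ r * q" using N(1) by (intro mult_right_mono) auto
  then have "N * q + e 0 < q ^ Suc r" using e0 by (simp add: mult.commute)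
  moreover have "(N * q + e 0) div q ^ p mod q = e p" if "p < Suc r" for p
  proof (cases p)
    case 0
    then show ?thesis using e0 by simp
  next
    case (Suc p')
    have "(N * q + e 0) div q ^ p = (N * q + e 0) div q div q ^ p'"
      by (simp add: Suc div_mult2_eq)
    also have "\<dots> = N div q ^ p'" using e0 by simp
    finally show ?thesis using N(2) Suc that by simp
  qed
  ultimately show ?case by blast
qed

section \<open>Greedy completion of a partially colored witness\<close>

lemma has_partial_grundy_coloring_extend:
  assumes G: "pair_graph G" and "S \<subseteq> pverts G"
    and "\<forall>v\<in>S. c v \<in> {1..k}"
    and "\<forall>(u, v)\<in>parcs G. u \<in> S \<longrightarrow> v \<in> S \<longrightarrow> c u \<noteq> c v"
    and "\<forall>i\<in>{1..k}. \<exists>v\<in>S. c v = i \<and> (\<forall>j\<in>{1..i - 1}. \<exists>u\<in>S. (v, u) \<in> parcs G \<and> c u = j)"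
  shows "has_partial_grundy_coloring G k"
  using assms(2-)
proof (induction "card (pverts G - S)" arbitrary: S c k)
  case 0
  interpret pair_graph G by (fact G)
  have "S = pverts G" using 0 by auto
  moreover have "u \<in> pverts G \<and> v \<in> pverts G" if "(u, v) \<in> parcs G" for u v
    using that by (metis arc_fst_in_verts arc_snd_in_verts fst_conv snd_conv)
  ultimately have "partial_grundy_coloring G k c"
    using "0.prems" unfolding partial_grundy_coloring_def proper_coloring_def by auto
  then show ?case unfolding has_partial_grundy_coloring_def by blast
next
  case (Suc x)
  interpret pair_graph G by (fact G)
  have sym: "(v, u) \<in> parcs G" if "(u, v) \<in> parcs G" for u v
    using that by (metis arcs_symmetric)
  obtain w where w: "w \<in> pverts G" "w \<notin> S" using Suc.hyps(2)
    by (metis DiffE card.empty equals0I nat.distinct(1))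
  define free where "free = (\<lambda>j::nat. 1 \<le> j \<and> (\<forall>u\<in>S. (w, u) \<in> parcs G \<longrightarrow> c u \<noteq> j))"
  \<comment> \<open>The greedy color of \<open>w\<close>. It is at most \<open>Suc k\<close>, since
    \<open>S\<close> uses only the colors up to \<open>k\<close>.\<close>
  define j where "j = (LEAST j. free j)"
  have "free (Suc k)" using Suc.prems(2) by (auto simp: free_def)
  then have j: "free j" "j \<le> Suc k" unfolding j_def by (auto intro: LeastI Least_le)
  have below: "\<exists>u\<in>S. (w, u) \<in> parcs G \<and> c u = i" if "i \<in> {1..j - 1}" for i
  proof -
    have "i < j" using that by auto
    then have "\<not> free i" unfolding j_def by (rule not_less_Least)
    then show ?thesis using that by (auto simp: free_def)
  qed
  define c' where "c' = c(w := j)"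
  define k' where "k' = max k j"
  have c'S: "c' v = c v" if "v \<in> S" for v using that w by (auto simp: c'_def)
  have old: "\<exists>v\<in>insert w S. c' v = i \<and> (\<forall>j\<in>{1..i - 1}. \<exists>u\<in>insert w S. (v, u) \<in> parcs G \<and> c' u = j)"
    if "i \<in> {1..k}" for i
    using Suc.prems(4) that c'S by (metis insertCI)
  \<comment> \<open>By minimality of \<open>j\<close>, the vertex \<open>w\<close> sees all smaller
    colors and is a witness for its own color; so if \<open>Suc k\<close> is opened as a new color,
    it comes with its witness.\<close>
  have new: "\<exists>v\<in>insert w S. c' v = j \<and> (\<forall>i\<in>{1..j - 1}. \<exists>u\<in>insert w S. (v, u) \<in> parcs G \<and> c' u = i)"
    using below c'S by (intro bexI[of _ w]) (auto simp: c'_def)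
  have "has_partial_grundy_coloring G k'"
  proof (rule Suc.hyps(1)[of "insert w S" c'])
    show "x = card (pverts G - insert w S)"
      using Suc.hyps(2) w by (metis DiffI Diff_insert card_Diff_singleton diff_Suc_1)
    show "insert w S \<subseteq> pverts G" using Suc.prems w by simp
    show "\<forall>v\<in>insert w S. c' v \<in> {1..k'}"
      using Suc.prems(2) j(1) by (auto simp: c'_def k'_def free_def)
    show "\<forall>(u, v)\<in>parcs G. u \<in> insert w S \<longrightarrow> v \<in> insert w S \<longrightarrow> c' u \<noteq> c' v"
    proof (clarify)
      fix u v assume a: "(u, v) \<in> parcs G" "u \<in> insert w S" "v \<in> insert w S" "c' u = c' v"
      have "u \<noteq> v" using a(1) by (metis no_loops')
      then consider "u \<in> S" "v \<in> S" | "u = w" "v \<in> S" | "u \<in> S" "v = w" using a by auto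
      then show False
        using a(1,4) Suc.prems(3) j(1) sym[OF a(1)] c'S
        by cases (auto simp: free_def c'_def split: if_splits)
    qed
    show "\<forall>i\<in>{1..k'}. \<exists>v\<in>insert w S. c' v = i \<and>
        (\<forall>j\<in>{1..i - 1}. \<exists>u\<in>insert w S. (v, u) \<in> parcs G \<and> c' u = j)"
    proof
      fix i assume "i \<in> {1..k'}"
      then have "i \<in> {1..k} \<or> i = j" using j(2) by (auto simp: k'_def)
      then show "\<exists>v\<in>insert w S. c' v = i \<and>
          (\<forall>j\<in>{1..i - 1}. \<exists>u\<in>insert w S. (v, u) \<in> parcs G \<and> c' u = j)"
        using old new by blast
    qed
  qed
  then show ?case unfolding has_partial_grundy_coloring_def k'_def
    by (meson max.bounded_iff)
qed

section \<open>Stack code with running time bounds\<close>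

abbreviation stk :: string where "stk \<equiv> ''stack''"

type_synonym code = "nat \<Rightarrow> program"

abbreviation slot :: "nat \<Rightarrow> expr" where "slot i \<equiv> Load stk (Const i)"
abbreviation put :: "nat \<Rightarrow> expr \<Rightarrow> program" where "put i \<equiv> Store stk (Const i)"

definition con :: "nat \<Rightarrow> code" where
  "con a = (\<lambda>D. put D (Const a))"

definition var :: "nat \<Rightarrow> code" where
  "var i = (\<lambda>D. put D (slot i))"

definition get :: "string \<Rightarrow> code \<Rightarrow> code" where
  "get x a = (\<lambda>D. Seq (a D) (put D (Load x (slot D))))"

definition add :: "code \<Rightarrow> code \<Rightarrow> code" where
  "add a b = (\<lambda>D. Seq (a D) (Seq (b (D + 1)) (put D (Add (slot D) (slot (D + 1))))))"

definition sub :: "code \<Rightarrow> code \<Rightarrow> code" where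
  "sub a b = (\<lambda>D. Seq (a D) (Seq (b (D + 1)) (put D (Sub (slot D) (slot (D + 1))))))"

definition ite :: "code \<Rightarrow> code \<Rightarrow> code \<Rightarrow> code" where
  "ite c a b = (\<lambda>D. Seq (c D) (Cond (slot D) (a D) (b D)))"

text \<open>A loop keeps its bound, its index and its accumulator in the slots \<open>D\<close>, \<open>D + 1\<close> and \<open>D + 2\<close>.\<close>

definition loop_body :: "(code \<Rightarrow> code \<Rightarrow> code) \<Rightarrow> code" where
  "loop_body s = (\<lambda>D. Seq (s (var (D + 1)) (var (D + 2)) (D + 3))
     (Seq (put (D + 2) (slot (D + 3))) (put (D + 1) (Add (slot (D + 1)) (Const 1)))))"

definition iter :: "code \<Rightarrow> code \<Rightarrow> (code \<Rightarrow> code \<Rightarrow> code) \<Rightarrow> code" where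
  "iter b a s = (\<lambda>D. Seq (b D) (Seq (put (D + 1) (Const 0)) (Seq (a (D + 2))
     (Seq (While (Sub (slot D) (slot (D + 1))) (loop_body s D)) (put D (slot (D + 2)))))))"

section \<open>Worlds and timed evaluation\<close>

definition frame :: "nat \<Rightarrow> memory \<Rightarrow> memory \<Rightarrow> bool" where
  "frame D m m' \<longleftrightarrow> (\<forall>x. x \<noteq> stk \<longrightarrow> m' x = m x) \<and> (\<forall>i<D. m' stk i = m stk i)"

lemma frame_refl: "frame D m m"
  by (simp add: frame_def)

lemma frame_trans: "frame D m m' \<Longrightarrow> frame D' m' m'' \<Longrightarrow> D \<le> D' \<Longrightarrow> frame D m m''"
  by (simp add: frame_def)

lemma frame_put: "D \<le> i \<Longrightarrow> frame D m (m(stk := (m stk)(i := v)))"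
  by (simp add: frame_def)

lemma runs_cong: "runs p m t m' \<Longrightarrow> t = t' \<Longrightarrow> runs p m t' m'"
  by simp

lemma runs_put: "runs (put i e) m (2 + expr_cost e) (m(stk := (m stk)(i := eval_expr e m)))"
  using runs.Store[of stk "Const i" e m] by simp

text \<open>A world is a stack depth with a memory. A later world may be deeper, but everything
  stored below the old depth is intact.\<close>

definition world_le :: "nat \<times> memory \<Rightarrow> nat \<times> memory \<Rightarrow> bool" (infix "\<preceq>" 50) where
  "w \<preceq> w' \<longleftrightarrow> fst w \<le> fst w' \<and> frame (fst w) (snd w) (snd w')"

lemma world_le_refl: "w \<preceq> w"
  by (simp add: world_le_def frame_refl)

lemma world_le_trans: "w \<preceq> w' \<Longrightarrow> w' \<preceq> w'' \<Longrightarrow> w \<preceq> w''"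
  unfolding world_le_def using frame_trans by fastforce

text \<open>\<open>A\<close> records the arrays outside the stack, which code only reads. Since
  \<open>M\<close> is at least 2, constant factors in running times are absorbed by a few more
  powers of \<open>M\<close>.\<close>

locale time_base =
  fixes M :: nat and A :: memory
  assumes M2: "2 \<le> M"
begin

definition agrees :: "memory \<Rightarrow> bool" where
  "agrees m \<longleftrightarrow> (\<forall>x. x \<noteq> stk \<longrightarrow> m x = A x)"

lemma agrees_frame: "frame D m m' \<Longrightarrow> agrees m \<Longrightarrow> agrees m'"
  by (simp add: frame_def agrees_def)

text \<open>Quantifying over all later worlds makes evaluation stable under
  \<open>\<preceq>\<close>: code handed to a loop body keeps its value at every depth at which the
  body runs it.\<close>

definition evals :: "nat \<times> memory \<Rightarrow> code \<Rightarrow> nat \<Rightarrow> nat \<Rightarrow> bool" where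
  "evals w a v j \<longleftrightarrow> (\<forall>D m. w \<preceq> (D, m) \<longrightarrow> agrees m \<longrightarrow>
     (\<exists>t m'. runs (a D) m t m' \<and> t \<le> M ^ j \<and> m' stk D = v \<and> frame D m m'))"

lemma evals_mono: "w \<preceq> w' \<Longrightarrow> evals w a v j \<Longrightarrow> evals w' a v j"
  unfolding evals_def using world_le_trans by blast

lemma evalsE:
  assumes "evals w a v j" and "w \<preceq> (D, m)" and "agrees m"
  obtains t m' where "runs (a D) m t m'" "t \<le> M ^ j" "m' stk D = v" "frame D m m'"
  using assms unfolding evals_def by blast

lemma const_le_power: "c \<le> 2 ^ l \<Longrightarrow> c \<le> M ^ l"
  using M2 by (meson order_trans power_mono zero_le)

lemma power_le: "i \<le> j \<Longrightarrow> M ^ i \<le> M ^ j"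
  using M2 by (intro power_increasing) auto

lemma power_pos: "1 \<le> M ^ i"
  using M2 by simp

lemma evals_le: "evals w a v i \<Longrightarrow> i \<le> j \<Longrightarrow> evals w a v j"
  unfolding evals_def using power_le le_trans by meson

lemma evals_con: "evals w (con a) a 2"
  unfolding evals_def con_def
proof (intro allI impI)
  fix D m
  show "\<exists>t m'. runs (put D (Const a)) m t m' \<and> t \<le> M ^ 2 \<and> m' stk D = a \<and> frame D m m'"
    using const_le_power[of 3 2] runs_put[of D "Const a" m] frame_put[of D D m a] by fastforce
qed

lemma evals_var:
  assumes "i < fst w"
  shows "evals w (var i) (snd w stk i) 2"
  unfolding evals_def var_def
proof (intro allI impI)
  fix D m assume "w \<preceq> (D, m)" and "agrees m"
  then have "m stk i = snd w stk i" using assms by (simp add: world_le_def frame_def)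
  then show "\<exists>t m'. runs (put D (slot i)) m t m' \<and> t \<le> M ^ 2 \<and> m' stk D = snd w stk i \<and> frame D m m'"
    using const_le_power[of 4 2] runs_put[of D "slot i" m] frame_put[of D D m "m stk i"] by fastforce
qed

lemma evals_get:
  assumes a: "evals w a v j" and x: "x \<noteq> stk"
  shows "evals w (get x a) (A x v) (j + 3)"
  unfolding evals_def get_def
proof (intro allI impI)
  fix D m assume le: "w \<preceq> (D, m)" and ag: "agrees m"
  from a le ag obtain t m' where 1: "runs (a D) m t m'" "t \<le> M ^ j" "m' stk D = v" "frame D m m'"
    by (rule evalsE)
  let ?m = "m'(stk := (m' stk)(D := m' x v))"
  have "runs (put D (Load x (slot D))) m' 5 ?m"
    using runs_put[of D "Load x (slot D)" m'] 1(3) by simp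
  from runs.Seq[OF 1(1) this] have "runs (Seq (a D) (put D (Load x (slot D)))) m (1 + t + 5) ?m" .
  moreover have "1 + t + 5 \<le> M ^ (j + 3)"
  proof -
    have "1 + t + 5 \<le> 7 * M ^ j" using 1(2) power_pos[of j] by linarith
    also have "\<dots> \<le> M ^ 3 * M ^ j" by (intro mult_right_mono const_le_power) auto
    finally show ?thesis by (simp add: power_add mult.commute)
  qed
  moreover have "m' x = A x" using agrees_frame[OF 1(4) ag] x by (simp add: agrees_def)
  moreover have "frame D m ?m" using 1(4) by (simp add: frame_def)
  ultimately show "\<exists>t m'. runs (Seq (a D) (put D (Load x (slot D)))) m t m' \<and> t \<le> M ^ (j + 3) \<and>
      m' stk D = A x v \<and> frame D m m'"
    by (intro exI[of _ "1 + t + 5"] exI[of _ ?m]) simp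
qed

lemma evals_binop:
  assumes a: "evals w a v i" and b: "evals w b u j"
    and cost: "\<And>D. expr_cost (f D) = 5" and val: "\<And>D m. eval_expr (f D) m = g (m stk D) (m stk (D + 1))"
  shows "evals w (\<lambda>D. Seq (a D) (Seq (b (D + 1)) (put D (f D)))) (g v u) (i + j + 4)"
  unfolding evals_def
proof (intro allI impI)
  fix D m assume le: "w \<preceq> (D, m)" and ag: "agrees m"
  from a le ag obtain t m1 where 1: "runs (a D) m t m1" "t \<le> M ^ i" "m1 stk D = v" "frame D m m1"
    by (rule evalsE)
  \<comment> \<open>The second operand runs one slot higher, so the value of the first survives in
    slot \<open>D\<close>.\<close>
  have "w \<preceq> (D + 1, m1)" using le 1(4) frame_trans by (auto simp: world_le_def)
  from b this agrees_frame[OF 1(4) ag] obtain s m2 where 2: "runs (b (D + 1)) m1 s m2" "s \<le> M ^ j" "m2 stk (D + 1) = u"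
      "frame (D + 1) m1 m2"
    by (rule evalsE)
  have "m2 stk D = v" using 2(4) 1(3) by (simp add: frame_def)
  let ?m = "m2(stk := (m2 stk)(D := g v u))"
  have "runs (put D (f D)) m2 7 ?m"
    using runs_put[of D "f D" m2] \<open>m2 stk D = v\<close> 2(3) val cost by simp
  from runs.Seq[OF 1(1) runs.Seq[OF 2(1) this]]
  have "runs (Seq (a D) (Seq (b (D + 1)) (put D (f D)))) m (1 + t + (1 + s + 7)) ?m" .
  moreover have "1 + t + (1 + s + 7) \<le> M ^ (i + j + 4)"
  proof -
    have "M ^ i \<le> M ^ (i + j)" "M ^ j \<le> M ^ (i + j)" by (auto intro: power_le)
    then have "1 + t + (1 + s + 7) \<le> 11 * M ^ (i + j)" using 1(2) 2(2) power_pos[of "i + j"] by linarith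
    also have "\<dots> \<le> M ^ 4 * M ^ (i + j)" by (intro mult_right_mono const_le_power) auto
    finally show ?thesis by (simp add: power_add mult.commute)
  qed
  moreover have "frame D m ?m"
    using 1(4) 2(4) by (simp add: frame_def)
  ultimately show "\<exists>t m'. runs (Seq (a D) (Seq (b (D + 1)) (put D (f D)))) m t m' \<and>
      t \<le> M ^ (i + j + 4) \<and> m' stk D = g v u \<and> frame D m m'"
    by (intro exI[of _ "1 + t + (1 + s + 7)"] exI[of _ ?m]) simp
qed

lemma evals_add: "evals w a v i \<Longrightarrow> evals w b u j \<Longrightarrow> evals w (add a b) (v + u) (i + j + 4)"
  unfolding add_def by (rule evals_binop) auto

lemma evals_sub: "evals w a v i \<Longrightarrow> evals w b u j \<Longrightarrow> evals w (sub a b) (v - u) (i + j + 4)"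
  unfolding sub_def by (rule evals_binop) auto

lemma evals_ite:
  assumes c: "evals w c u i" and a: "u \<noteq> 0 \<Longrightarrow> evals w a v j" and b: "u = 0 \<Longrightarrow> evals w b v' l"
  shows "evals w (ite c a b) (if u \<noteq> 0 then v else v') (i + j + l + 3)"
  unfolding evals_def ite_def
proof (intro allI impI)
  fix D m assume le: "w \<preceq> (D, m)" and ag: "agrees m"
  let ?v = "if u \<noteq> 0 then v else v'"
  from c le ag obtain t m1 where 1: "runs (c D) m t m1" "t \<le> M ^ i" "m1 stk D = u" "frame D m m1"
    by (rule evalsE)
  have le1: "w \<preceq> (D, m1)" using le 1(4) frame_trans by (auto simp: world_le_def)
  obtain s m2 where 2: "runs (Cond (slot D) (a D) (b D)) m1 (3 + s) m2" "s \<le> M ^ (j + l)"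
      "m2 stk D = ?v" "frame D m1 m2"
  proof (cases "u = 0")
    case True
    obtain s m2 where r: "runs (b D) m1 s m2" "s \<le> M ^ l" "m2 stk D = v'" "frame D m1 m2"
      using b[OF True] le1 agrees_frame[OF 1(4) ag] by (rule evalsE)
    have "runs (Cond (slot D) (a D) (b D)) m1 (3 + s) m2"
      by (rule runs_cong[OF runs.CondFalse[OF _ r(1)]]) (use True 1(3) in auto)
    moreover have "s \<le> M ^ (j + l)" using r(2) power_le[of l "j + l"] by simp
    ultimately show ?thesis using that r(3,4) True by simp
  next
    case False
    obtain s m2 where r: "runs (a D) m1 s m2" "s \<le> M ^ j" "m2 stk D = v" "frame D m1 m2"
      using a[OF False] le1 agrees_frame[OF 1(4) ag] by (rule evalsE)
    have "runs (Cond (slot D) (a D) (b D)) m1 (3 + s) m2"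
      by (rule runs_cong[OF runs.CondTrue[OF _ r(1)]]) (use False 1(3) in auto)
    moreover have "s \<le> M ^ (j + l)" using r(2) power_le[of j "j + l"] by simp
    ultimately show ?thesis using that r(3,4) False by simp
  qed
  have "runs (Seq (c D) (Cond (slot D) (a D) (b D))) m (1 + t + (3 + s)) m2"
    by (rule runs.Seq[OF 1(1) 2(1)])
  moreover have "1 + t + (3 + s) \<le> M ^ (i + j + l + 3)"
  proof -
    have "M ^ i \<le> M ^ (i + j + l)" "M ^ (j + l) \<le> M ^ (i + j + l)" by (auto intro: power_le)
    then have "1 + t + (3 + s) \<le> 6 * M ^ (i + j + l)"
      using 1(2) 2(2) power_pos[of "i + j + l"] by linarith
    also have "\<dots> \<le> M ^ 3 * M ^ (i + j + l)" by (intro mult_right_mono const_le_power) auto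
    finally show ?thesis by (simp add: power_add mult.commute)
  qed
  ultimately show "\<exists>t m'. runs (Seq (c D) (Cond (slot D) (a D) (b D))) m t m' \<and>
      t \<le> M ^ (i + j + l + 3) \<and> m' stk D = ?v \<and> frame D m m'"
    using 2(3) frame_trans[OF 1(4) 2(4)] by blast
qed

text \<open>The invariant is that slot \<open>D + 2\<close> holds \<open>F i\<close>. A round costs
  18 steps besides those of \<open>s\<close>, rounded up to 22, and the failing test at the end
  costs 6. The body is assumed to work in every world after \<open>m0\<close>, hence in each
  round.\<close>

lemma runs_loop:
  assumes body: "\<And>i w' x y. i < n \<Longrightarrow> (D, m0) \<preceq> w' \<Longrightarrow> evals w' x i 2 \<Longrightarrow> evals w' y (F i) 2 \<Longrightarrow>
      evals w' (s x y) (F (Suc i)) j"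
    and "agrees m" "frame D m0 m" "m stk D = n" "m stk (D + 1) = i" "m stk (D + 2) = F i" "i \<le> n"
  shows "\<exists>t m'. runs (While (Sub (slot D) (slot (D + 1))) (loop_body s D)) m t m' \<and>
      t \<le> (n - i) * (M ^ j + 22) + 6 \<and> m' stk (D + 2) = F n \<and> frame D m0 m'"
  using assms(2-)
proof (induction "n - i" arbitrary: i m)
  case 0
  then have "runs (While (Sub (slot D) (slot (D + 1))) (loop_body s D)) m 6 m"
    by (intro runs_cong[OF runs.WhileFalse]) auto
  then show ?case using 0 by (intro exI[of _ 6] exI[of _ m]) auto
next
  case (Suc r)
  then have i: "i < n" by simp
  \<comment> \<open>The body runs at depth \<open>D + 3\<close>, so the three loop slots lie below
    it and behave as read-only variables.\<close>
  have "evals (D + 3, m) (var (D + 1)) i 2" "evals (D + 3, m) (var (D + 2)) (F i) 2"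
    using evals_var[of "D + 1" "(D + 3, m)"] evals_var[of "D + 2" "(D + 3, m)"] Suc.prems by auto
  moreover have "(D, m0) \<preceq> (D + 3, m)" using Suc.prems(2) by (simp add: world_le_def)
  ultimately have "evals (D + 3, m) (s (var (D + 1)) (var (D + 2))) (F (Suc i)) j"
    using body i by blast
  then obtain t m1 where 1: "runs (s (var (D + 1)) (var (D + 2)) (D + 3)) m t m1" "t \<le> M ^ j"
      "m1 stk (D + 3) = F (Suc i)" "frame (D + 3) m m1"
    using world_le_refl Suc.prems(1) by (rule evalsE)
  have old: "m1 stk D = n" "m1 stk (D + 1) = i" using 1(4) Suc.prems by (auto simp: frame_def)
  define m2 where "m2 = m1(stk := (m1 stk)(D + 2 := F (Suc i)))"
  define m3 where "m3 = m2(stk := (m2 stk)(D + 1 := Suc i))"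
  have r2: "runs (put (D + 2) (slot (D + 3))) m1 4 m2"
    using runs_put[of "D + 2" "slot (D + 3)" m1] 1(3) by (simp add: m2_def)
  have r3: "runs (put (D + 1) (Add (slot (D + 1)) (Const 1))) m2 6 m3"
    using runs_put[of "D + 1" "Add (slot (D + 1)) (Const 1)" m2] old(2) by (simp add: m2_def m3_def)
  from runs.Seq[OF 1(1) runs.Seq[OF r2 r3]]
  have rb: "runs (loop_body s D) m (1 + t + 11) m3" by (simp add: loop_body_def)
  have fr: "frame D m0 m3"
    using Suc.prems(2) 1(4) by (simp add: frame_def m2_def m3_def)
  have ag3: "agrees m3"
    using agrees_frame[OF 1(4) Suc.prems(1)] by (simp add: agrees_def m2_def m3_def)
  have "r = n - Suc i" using Suc.hyps(2) by simp
  moreover have "m3 stk D = n" "m3 stk (D + 1) = Suc i" "m3 stk (D + 2) = F (Suc i)"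
    using old by (auto simp: m2_def m3_def)
  ultimately obtain t' m' where R: "runs (While (Sub (slot D) (slot (D + 1))) (loop_body s D)) m3 t' m'"
      "t' \<le> (n - Suc i) * (M ^ j + 22) + 6" "m' stk (D + 2) = F n" "frame D m0 m'"
    using Suc.hyps(1)[of "Suc i" m3] ag3 fr i by auto
  have "eval_expr (Sub (slot D) (slot (D + 1))) m \<noteq> 0" using Suc.prems i by simp
  from runs.WhileTrue[OF this rb R(1)]
  have "runs (While (Sub (slot D) (slot (D + 1))) (loop_body s D)) m (18 + t + t') m'"
    by (simp add: add.commute add.left_commute)
  moreover have "18 + t + t' \<le> (n - i) * (M ^ j + 22) + 6"
  proof -
    have "n - i = Suc (n - Suc i)" using i by simp
    then show ?thesis using R(2) 1(2) by simp
  qed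
  ultimately show ?case using R(3,4) by blast
qed

lemma evals_iter:
  assumes b: "evals w b n i" and n: "n \<le> M" and a: "evals w a (F 0) l"
    and body: "\<And>i w' x y. i < n \<Longrightarrow> w \<preceq> w' \<Longrightarrow> evals w' x i 2 \<Longrightarrow> evals w' y (F i) 2 \<Longrightarrow>
      evals w' (s x y) (F (Suc i)) j"
  shows "evals w (iter b a s) (F n) (i + l + j + 7)"
  unfolding evals_def iter_def
proof (intro allI impI)
  fix D m assume le: "w \<preceq> (D, m)" and ag: "agrees m"
  from b le ag obtain t1 m1 where 1: "runs (b D) m t1 m1" "t1 \<le> M ^ i" "m1 stk D = n" "frame D m m1"
    by (rule evalsE)
  define m2 where "m2 = m1(stk := (m1 stk)(D + 1 := 0))"
  have r2: "runs (put (D + 1) (Const 0)) m1 3 m2"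
    using runs_put[of "D + 1" "Const 0" m1] by (simp add: m2_def)
  have le2: "w \<preceq> (D + 2, m2)" using le 1(4) by (auto simp: world_le_def m2_def frame_def)
  have ag2: "agrees m2" using agrees_frame[OF 1(4) ag] by (simp add: agrees_def m2_def)
  from a le2 ag2 obtain t3 m3 where 3: "runs (a (D + 2)) m2 t3 m3" "t3 \<le> M ^ l" "m3 stk (D + 2) = F 0"
      "frame (D + 2) m2 m3"
    by (rule evalsE)
  have fr: "frame D m m3" using 1(4) 3(4) by (auto simp: frame_def m2_def)
  have le3: "w \<preceq> w'" if "(D, m) \<preceq> w'" for w' using le that world_le_trans by blast
  have "\<exists>t m'. runs (While (Sub (slot D) (slot (D + 1))) (loop_body s D)) m3 t m' \<and>
      t \<le> (n - 0) * (M ^ j + 22) + 6 \<and> m' stk (D + 2) = F n \<and> frame D m m'"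
    using body le3 agrees_frame[OF 3(4) ag2] fr 1(3) 3(3,4)
    by (intro runs_loop) (auto simp: frame_def m2_def)
  then obtain t4 m4 where 4: "runs (While (Sub (slot D) (slot (D + 1))) (loop_body s D)) m3 t4 m4"
      "t4 \<le> n * (M ^ j + 22) + 6" "m4 stk (D + 2) = F n" "frame D m m4"
    by auto
  define m5 where "m5 = m4(stk := (m4 stk)(D := F n))"
  have r5: "runs (put D (slot (D + 2))) m4 4 m5"
    using runs_put[of D "slot (D + 2)" m4] 4(3) by (simp add: m5_def)
  let ?t = "1 + t1 + (1 + 3 + (1 + t3 + (1 + t4 + 4)))"
  note run = runs.Seq[OF 1(1) runs.Seq[OF r2 runs.Seq[OF 3(1) runs.Seq[OF 4(1) r5]]]]
  have "?t \<le> M ^ (i + l + j + 7)"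
  \<comment> \<open>One power of \<open>M\<close> pays for at most \<open>M\<close> rounds, six more
    for the constant factor 64.\<close>
  proof -
    let ?X = "M ^ (i + l + j + 1)"
    have "M ^ i \<le> ?X" "M ^ l \<le> ?X" by (rule power_le, simp)+
    moreover have "n * (M ^ j + 22) \<le> 23 * ?X"
    proof -
      have "n * (M ^ j + 22) \<le> M * (23 * M ^ j)" using n power_pos[of j] by (intro mult_mono) auto
      also have "\<dots> = 23 * M ^ (j + 1)" by simp
      also have "\<dots> \<le> 23 * ?X" by (intro mult_left_mono power_le) auto
      finally show ?thesis .
    qed
    ultimately have "?t \<le> 64 * ?X" using 1(2) 3(2) 4(2) power_pos[of "i + l + j + 1"] by linarith
    also have "\<dots> \<le> M ^ 6 * ?X" by (intro mult_right_mono const_le_power) auto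
    also have "\<dots> = M ^ (6 + (i + l + j + 1))" by (rule power_add[symmetric])
    also have "\<dots> = M ^ (i + l + j + 7)" by (rule arg_cong[of _ _ "\<lambda>x. M ^ x"]) simp
    finally show ?thesis .
  qed
  moreover have "m5 stk D = F n" "frame D m m5" using 4(4) by (auto simp: m5_def frame_def)
  ultimately show "\<exists>t m'. runs (Seq (b D) (Seq (put (D + 1) (Const 0)) (Seq (a (D + 2))
     (Seq (While (Sub (slot D) (slot (D + 1))) (loop_body s D)) (put D (slot (D + 2))))))) m t m' \<and>
     t \<le> M ^ (i + l + j + 7) \<and> m' stk D = F n \<and> frame D m m'"
    using run by blast
qed

end

section \<open>Comparisons, bounded quantifiers and arithmetic\<close>

definition le :: "code \<Rightarrow> code \<Rightarrow> code" where
  "le a b = ite (sub a b) (con 0) (con 1)"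

definition lt :: "code \<Rightarrow> code \<Rightarrow> code" where
  "lt a b = le (add a (con 1)) b"

text \<open>Subtraction is truncated, so both differences vanish together only for equal
  values.\<close>

definition eqc :: "code \<Rightarrow> code \<Rightarrow> code" where
  "eqc a b = ite (add (sub a b) (sub b a)) (con 0) (con 1)"

definition nonzero :: "code \<Rightarrow> code" where
  "nonzero a = ite a (con 1) (con 0)"

definition conj :: "code \<Rightarrow> code \<Rightarrow> code" where
  "conj a b = ite a b (con 0)"

definition imp :: "code \<Rightarrow> code \<Rightarrow> code" where
  "imp a b = ite a b (con 1)"

definition ex_below :: "code \<Rightarrow> (code \<Rightarrow> code) \<Rightarrow> code" where
  "ex_below b s = iter b (con 0) (\<lambda>x y. ite y (con 1) (s x))"

definition all_below :: "code \<Rightarrow> (code \<Rightarrow> code) \<Rightarrow> code" where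
  "all_below b s = iter b (con 1) (\<lambda>x y. ite y (s x) (con 0))"

definition sum_below :: "code \<Rightarrow> (code \<Rightarrow> code) \<Rightarrow> code" where
  "sum_below b s = iter b (con 0) (\<lambda>x y. add y (s x))"

definition max_below :: "code \<Rightarrow> (code \<Rightarrow> code) \<Rightarrow> code" where
  "max_below b s = iter b (con 0) (\<lambda>x y. ite (le (s x) y) y (s x))"

definition last_below :: "code \<Rightarrow> (code \<Rightarrow> code) \<Rightarrow> (code \<Rightarrow> code) \<Rightarrow> code" where
  "last_below b s g = iter b (con 0) (\<lambda>x y. ite (s x) (g x) y)"

text \<open>The default \<open>0\<close> is meaningful: it is the quotient when the divisor exceeds
  the dividend, and it is the color of a vertex that matches no guess.\<close>

primrec last_value :: "(nat \<Rightarrow> bool) \<Rightarrow> (nat \<Rightarrow> nat) \<Rightarrow> nat \<Rightarrow> nat" where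
  "last_value P g 0 = 0"
| "last_value P g (Suc i) = (if P i then g i else last_value P g i)"

text \<open>Only the first factor counts rounds, so only it has to stay below \<open>M\<close>; the
  product, and with it the value of \<open>pow\<close>, may be larger.\<close>

definition mul :: "code \<Rightarrow> code \<Rightarrow> code" where
  "mul a b = iter a (con 0) (\<lambda>_ y. add y b)"

definition pow :: "code \<Rightarrow> code \<Rightarrow> code" where
  "pow a b = iter b (con 1) (\<lambda>_ y. mul a y)"

text \<open>Division by linear search; candidates up to \<open>a\<close> suffice for a positive
  divisor.\<close>

definition quot :: "code \<Rightarrow> code \<Rightarrow> code" where
  "quot a b = last_below a (\<lambda>x. le (mul (add x (con 1)) b) a) (\<lambda>x. add x (con 1))"

definition rem :: "code \<Rightarrow> code \<Rightarrow> code" where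
  "rem a b = sub a (mul (quot a b) b)"

context time_base
begin

text \<open>The first rule in the proofs about compound code: the rules for the pieces synthesize a
  value and an exponent, which are compared with the announced ones at the end.\<close>

lemma evals_cong: "evals w a v j \<Longrightarrow> v = v' \<Longrightarrow> j \<le> j' \<Longrightarrow> evals w a v' j'"
  using evals_le by blast

lemma evals_less_eq: "evals w a v i \<Longrightarrow> evals w b u j \<Longrightarrow> evals w (le a b) (of_bool (v \<le> u)) (i + j + 11)"
  unfolding le_def by (rule evals_cong[OF evals_ite[OF evals_sub evals_con evals_con]]) auto

lemma evals_lt: "evals w a v i \<Longrightarrow> evals w b u j \<Longrightarrow> evals w (lt a b) (of_bool (v < u)) (i + j + 17)"
  unfolding lt_def by (rule evals_cong[OF evals_less_eq[OF evals_add[OF _ evals_con]]]) auto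

lemma evals_eqc:
  "evals w a v i \<Longrightarrow> evals w b u j \<Longrightarrow> evals w (eqc a b) (of_bool (v = u)) (2 * i + 2 * j + 19)"
  unfolding eqc_def
  by (rule evals_cong[OF evals_ite[OF evals_add[OF evals_sub evals_sub] evals_con evals_con]]) auto

lemma evals_nonzero: "evals w a v i \<Longrightarrow> evals w (nonzero a) (of_bool (v \<noteq> 0)) (i + 7)"
  unfolding nonzero_def by (rule evals_cong[OF evals_ite[OF _ evals_con evals_con]]) auto

lemma evals_conj:
  "evals w a (of_bool P) i \<Longrightarrow> evals w b (of_bool Q) j \<Longrightarrow>
   evals w (conj a b) (of_bool (P \<and> Q)) (i + j + 5)"
  unfolding conj_def by (rule evals_cong[OF evals_ite[OF _ _ evals_con]]) auto

lemma evals_imp: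
  "evals w a (of_bool P) i \<Longrightarrow> evals w b (of_bool Q) j \<Longrightarrow>
   evals w (imp a b) (of_bool (P \<longrightarrow> Q)) (i + j + 5)"
  unfolding imp_def by (rule evals_cong[OF evals_ite[OF _ _ evals_con]]) auto

lemma evals_ex_below:
  assumes "evals w b n i" and "n \<le> M"
    and s: "\<And>l w' x. l < n \<Longrightarrow> w \<preceq> w' \<Longrightarrow> evals w' x l 2 \<Longrightarrow> evals w' (s x) (of_bool (P l)) j"
  shows "evals w (ex_below b s) (of_bool (\<exists>l<n. P l)) (i + j + 16)"
  unfolding ex_below_def
proof (rule evals_cong[OF evals_iter[where F = "\<lambda>i. of_bool (\<exists>l<i. P l)"]])
  show "evals w b n i" "n \<le> M" by fact+
  show "evals w (con 0) (of_bool (\<exists>l<0. P l)) 2" using evals_con[of w 0] by simp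
  fix l w' x y
  assume a: "l < n" "w \<preceq> w'" "evals w' x l 2" "evals w' y (of_bool (\<exists>i<l. P i)) 2"
  show "evals w' (ite y (con 1) (s x)) (of_bool (\<exists>i<Suc l. P i)) (j + 7)"
    by (rule evals_cong[OF evals_ite[OF a(4) evals_con s[OF a(1,2,3)]]]) (auto simp: less_Suc_eq)
qed auto

lemma evals_all_below:
  assumes "evals w b n i" and "n \<le> M"
    and s: "\<And>l w' x. l < n \<Longrightarrow> w \<preceq> w' \<Longrightarrow> evals w' x l 2 \<Longrightarrow> evals w' (s x) (of_bool (P l)) j"
  shows "evals w (all_below b s) (of_bool (\<forall>l<n. P l)) (i + j + 16)"
  unfolding all_below_def
proof (rule evals_cong[OF evals_iter[where F = "\<lambda>i. of_bool (\<forall>l<i. P l)"]])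
  show "evals w b n i" "n \<le> M" by fact+
  show "evals w (con 1) (of_bool (\<forall>l<0. P l)) 2" using evals_con[of w 1] by simp
  fix l w' x y
  assume a: "l < n" "w \<preceq> w'" "evals w' x l 2" "evals w' y (of_bool (\<forall>i<l. P i)) 2"
  show "evals w' (ite y (s x) (con 0)) (of_bool (\<forall>i<Suc l. P i)) (j + 7)"
    by (rule evals_cong[OF evals_ite[OF a(4) s[OF a(1,2,3)] evals_con]]) (auto simp: less_Suc_eq)
qed auto

lemma evals_sum_below:
  assumes "evals w b n i" and "n \<le> M"
    and s: "\<And>l w' x. l < n \<Longrightarrow> w \<preceq> w' \<Longrightarrow> evals w' x l 2 \<Longrightarrow> evals w' (s x) (f l) j"
  shows "evals w (sum_below b s) (\<Sum>l<n. f l) (i + j + 15)"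
  unfolding sum_below_def
proof (rule evals_cong[OF evals_iter[where F = "\<lambda>i. \<Sum>l<i. f l"]])
  show "evals w b n i" "n \<le> M" by fact+
  show "evals w (con 0) (\<Sum>l<0. f l) 2" using evals_con[of w 0] by simp
  fix l w' x y
  assume a: "l < n" "w \<preceq> w'" "evals w' x l 2" "evals w' y (\<Sum>i<l. f i) 2"
  show "evals w' (add y (s x)) (\<Sum>i<Suc l. f i) (j + 6)"
    by (rule evals_cong[OF evals_add[OF a(4) s[OF a(1,2,3)]]]) auto
qed auto

lemma evals_max_below:
  assumes "evals w b n i" and "n \<le> M"
    and s: "\<And>l w' x. l < n \<Longrightarrow> w \<preceq> w' \<Longrightarrow> evals w' x l 2 \<Longrightarrow> evals w' (s x) (f l) j"
  shows "evals w (max_below b s) (Max (insert 0 (f ` {..<n}))) (i + 2 * j + 27)"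
  unfolding max_below_def
proof (rule evals_cong[OF evals_iter[where F = "\<lambda>i. Max (insert 0 (f ` {..<i}))"]])
  show "evals w b n i" "n \<le> M" by fact+
  show "evals w (con 0) (Max (insert 0 (f ` {..<0}))) 2" using evals_con[of w 0] by simp
  fix l w' x y
  let ?F = "\<lambda>i. Max (insert 0 (f ` {..<i}))"
  assume a: "l < n" "w \<preceq> w'" "evals w' x l 2" "evals w' y (?F l) 2"
  have "?F (Suc l) = Max (insert (f l) (insert 0 (f ` {..<l})))"
    by (simp add: lessThan_Suc insert_commute)
  also have "\<dots> = max (f l) (?F l)" by (rule Max_insert) auto
  finally show "evals w' (ite (le (s x) y) y (s x)) (?F (Suc l)) (2 * j + 18)"
    by (intro evals_cong[OF evals_ite[OF evals_less_eq[OF s[OF a(1,2,3)] a(4)] a(4) s[OF a(1,2,3)]]]) auto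
qed auto

lemma evals_last_below:
  assumes "evals w b n i" and "n \<le> M"
    and s: "\<And>l w' x. l < n \<Longrightarrow> w \<preceq> w' \<Longrightarrow> evals w' x l 2 \<Longrightarrow> evals w' (s x) (of_bool (P l)) j"
    and g: "\<And>l w' x. l < n \<Longrightarrow> w \<preceq> w' \<Longrightarrow> evals w' x l 2 \<Longrightarrow> evals w' (g x) (f l) j'"
  shows "evals w (last_below b s g) (last_value P f n) (i + j + j' + 14)"
  unfolding last_below_def
proof (rule evals_cong[OF evals_iter[where F = "last_value P f"]])
  show "evals w b n i" "n \<le> M" by fact+
  show "evals w (con 0) (last_value P f 0) 2" using evals_con[of w 0] by simp
  fix l w' x y
  assume a: "l < n" "w \<preceq> w'" "evals w' x l 2" "evals w' y (last_value P f l) 2"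
  show "evals w' (ite (s x) (g x) y) (last_value P f (Suc l)) (j + j' + 5)"
    by (rule evals_cong[OF evals_ite[OF s[OF a(1,2,3)] g[OF a(1,2,3)] a(4)]]) auto
qed auto

lemma evals_mul:
  assumes "evals w a v i" and "v \<le> M" and b: "evals w b u j"
  shows "evals w (mul a b) (v * u) (i + j + 15)"
  unfolding mul_def
proof (rule evals_cong[OF evals_iter[where F = "\<lambda>i. i * u"]])
  show "evals w a v i" "v \<le> M" by fact+
  show "evals w (con 0) (0 * u) 2" using evals_con[of w 0] by simp
  fix l w' x y
  assume a: "w \<preceq> w'" "evals w' y (l * u) 2"
  show "evals w' (add y b) (Suc l * u) (j + 6)"
    by (rule evals_cong[OF evals_add[OF a(2) evals_mono[OF a(1) b]]]) auto
qed auto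

lemma evals_pow:
  assumes a: "evals w a v i" and "v \<le> M" and "evals w b u j" and "u \<le> M"
  shows "evals w (pow a b) (v ^ u) (i + j + 26)"
  unfolding pow_def
proof (rule evals_cong[OF evals_iter[where F = "\<lambda>i. v ^ i"]])
  show "evals w b u j" "u \<le> M" by fact+
  show "evals w (con 1) (v ^ 0) 2" using evals_con[of w 1] by simp
  fix l w' x y
  assume "w \<preceq> w'" "evals w' y (v ^ l) 2"
  then show "evals w' (mul a y) (v ^ Suc l) (i + 17)"
    by (intro evals_cong[OF evals_mul[OF evals_mono[OF _ a] \<open>v \<le> M\<close>]]) auto
qed auto

lemma evals_quot:
  assumes a: "evals w a v i" and "v \<le> M" and b: "evals w b u j" and "u > 0"
  shows "evals w (quot a b) (v div u) (2 * i + j + 100)"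
proof -
  \<comment> \<open>The test holds exactly for \<open>l < v div u\<close>, so the search climbs with
    \<open>l\<close> until it saturates at the quotient.\<close>
  have "last_value (\<lambda>l. (l + 1) * u \<le> v) (\<lambda>l. l + 1) l = min l (v div u)" for l
  proof (induction l)
    case (Suc l)
    have "(l + 1) * u \<le> v \<longleftrightarrow> l + 1 \<le> v div u" using \<open>u > 0\<close> by (simp add: less_eq_div_iff_mult_less_eq)
    then show ?case using Suc by auto
  qed simp
  then have *: "last_value (\<lambda>l. (l + 1) * u \<le> v) (\<lambda>l. l + 1) v = v div u"
    by (simp add: min_absorb2)
  show ?thesis unfolding quot_def
  proof (rule evals_cong[OF evals_last_below[OF a \<open>v \<le> M\<close>] *])
    fix l w' x assume l: "l < v" "w \<preceq> w'" "evals w' x l 2"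
    show "evals w' (le (mul (add x (con 1)) b) a) (of_bool ((l + 1) * u \<le> v)) (i + j + 60)"
      by (rule evals_cong[OF evals_less_eq[OF evals_mul[OF evals_add[OF l(3) evals_con]]]])
        (use l \<open>v \<le> M\<close> evals_mono[OF l(2)] a b in auto)
    show "evals w' (add x (con 1)) (l + 1) 8"
      by (rule evals_cong[OF evals_add[OF l(3) evals_con]]) auto
  qed auto
qed

lemma evals_rem:
  assumes "evals w a v i" and "v \<le> M" and "evals w b u j" and "u > 0"
  shows "evals w (rem a b) (v mod u) (3 * i + 2 * j + 200)"
  unfolding rem_def
proof (rule evals_cong[OF evals_sub[OF assms(1) evals_mul[OF evals_quot[OF assms] _ assms(3)]]])
  show "v div u \<le> M" using \<open>v \<le> M\<close> by (meson div_le_dividend order_trans)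
  show "v - v div u * u = v mod u" by (simp add: minus_div_mult_eq_mod)
qed auto

lemmas evals_intros = evals_con evals_get evals_add evals_sub evals_less_eq evals_lt evals_eqc
  evals_nonzero evals_conj evals_imp evals_ex_below evals_all_below evals_sum_below
  evals_max_below evals_last_below evals_mul evals_pow evals_quot evals_rem

end

section \<open>The algorithm\<close>

definition num_vertices :: code where "num_vertices = get ''n'' (con 0)"
definition num_colors :: code where "num_colors = get ''k'' (con 0)"
definition pos :: "code \<Rightarrow> code" where "pos a = get ''pos'' a"
definition edge :: "code \<Rightarrow> code \<Rightarrow> code" where
  "edge a b = nonzero (get ''adj'' (add (mul a num_vertices) b))"

text \<open>The peeling stage stamps each removed vertex with a positive time in
  \<open>pos\<close>.\<close>

definition alive :: "code \<Rightarrow> code" where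
  "alive a = eqc (pos a) (con 0)"
definition alive_degree :: "code \<Rightarrow> code" where
  "alive_degree a = sum_below num_vertices (\<lambda>u. conj (edge a u) (alive u))"
text \<open>The next vertex of a smallest-last ordering; ties go to the largest vertex
  number.\<close>

definition select :: code where
  "select = last_below num_vertices
     (\<lambda>v. conj (alive v) (all_below num_vertices (\<lambda>u. imp (alive u) (le (alive_degree v) (alive_degree u)))))
     (\<lambda>v. v)"

definition later :: "code \<Rightarrow> code \<Rightarrow> code" where
  "later a b = conj (edge a b) (lt (pos a) (pos b))"
text \<open>The degeneracy is not part of the input. It is replaced by the largest out-degree of the
  orientation found, which is at most the degeneracy.\<close>

definition later_degree :: code where
  "later_degree = max_below num_vertices (\<lambda>v. sum_below num_vertices (later v))"
text \<open>The binary logarithm rounded up: the exponent grows until its power of two reaches the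
  number of vertices.\<close>

definition log_n :: code where
  "log_n = iter num_vertices (con 0) (\<lambda>_ y. ite (lt (pow (con 2) y) num_vertices) (add y (con 1)) y)"
definition sample_size :: code where
  "sample_size = mul (mul num_colors num_colors) (add later_degree (con 1))"
definition max_modulus :: code where
  "max_modulus = mul (con 2) (add (mul log_n (mul sample_size sample_size)) (con 1))"

definition color :: "code \<Rightarrow> code \<Rightarrow> code \<Rightarrow> code" where
  "color q N a = last_below (mul num_colors num_colors)
     (\<lambda>p. eqc (rem (quot N (pow q p)) q) (rem a q)) (\<lambda>p. add (quot p num_colors) (con 1))"
text \<open>The inner implication to \<open>con 0\<close> is a negation.\<close>

definition kept :: "code \<Rightarrow> code \<Rightarrow> code \<Rightarrow> code" where
  "kept q N a = conj (nonzero (color q N a))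
     (all_below num_vertices (\<lambda>u. imp (later a u) (imp (eqc (color q N u) (color q N a)) (con 0))))"
definition witnessed :: "code \<Rightarrow> code \<Rightarrow> code" where
  "witnessed q N = all_below num_colors (\<lambda>i. ex_below num_vertices (\<lambda>v. conj (kept q N v)
     (conj (eqc (color q N v) (add i (con 1)))
       (all_below i (\<lambda>j. ex_below num_vertices (\<lambda>u. conj (edge v u)
         (conj (kept q N u) (eqc (color q N u) (add j (con 1)))))))))) "
text \<open>Loops count from 0; the shift to \<open>q + 1\<close> keeps the modulus
  positive.\<close>

definition answer :: code where
  "answer = ex_below max_modulus (\<lambda>q. ex_below (pow (add q (con 1)) (mul num_colors num_colors))
     (\<lambda>N. witnessed (add q (con 1)) N))"

primrec log_upto :: "nat \<Rightarrow> nat \<Rightarrow> nat" where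
  "log_upto n 0 = 0"
| "log_upto n (Suc i) = (if 2 ^ log_upto n i < n then Suc (log_upto n i) else log_upto n i)"

text \<open>
  Digit \<open>p\<close> of \<open>N\<close> in base \<open>q\<close> is the guessed residue of witness vertex number \<open>p\<close>, whose color is
  \<open>p div k + 1\<close>; color \<open>0\<close> means uncolored.
\<close>

definition hash_color :: "nat \<Rightarrow> nat \<Rightarrow> nat \<Rightarrow> nat \<Rightarrow> nat" where
  "hash_color k q N v =
     last_value (\<lambda>p. N div q ^ p mod q = v mod q) (\<lambda>p. p div k + 1) (k * k)"

text \<open>An out-neighbor \<open>u\<close> counts whether or not it is itself kept, which avoids
  recursion along \<open>\<pi>\<close>. In return, the out-neighbors of witness vertices have to be
  separated from the witness as well.\<close>

definition kept_vertex :: "nat \<Rightarrow> (nat \<Rightarrow> nat \<Rightarrow> bool) \<Rightarrow> (nat \<Rightarrow> nat) \<Rightarrow> (nat \<Rightarrow> nat) \<Rightarrow> nat \<Rightarrow> bool" where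
  "kept_vertex n E \<pi> f v \<longleftrightarrow> f v \<noteq> 0 \<and> (\<forall>u<n. E v u \<and> \<pi> v < \<pi> u \<longrightarrow> f u \<noteq> f v)"

definition all_witnessed :: "nat \<Rightarrow> nat \<Rightarrow> (nat \<Rightarrow> nat \<Rightarrow> bool) \<Rightarrow> (nat \<Rightarrow> nat) \<Rightarrow> (nat \<Rightarrow> nat) \<Rightarrow> bool" where
  "all_witnessed n k E \<pi> f \<longleftrightarrow> (\<forall>i<k. \<exists>v<n. kept_vertex n E \<pi> f v \<and> f v = i + 1 \<and>
     (\<forall>j<i. \<exists>u<n. E v u \<and> kept_vertex n E \<pi> f u \<and> f u = j + 1))"

definition later_degree_max :: "nat \<Rightarrow> (nat \<Rightarrow> nat \<Rightarrow> bool) \<Rightarrow> (nat \<Rightarrow> nat) \<Rightarrow> nat" where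
  "later_degree_max n E \<pi> = Max (insert 0 ((\<lambda>v. \<Sum>u<n. of_bool (E v u \<and> \<pi> v < \<pi> u)) ` {..<n}))"

definition minimal_alive :: "nat \<Rightarrow> (nat \<Rightarrow> nat \<Rightarrow> bool) \<Rightarrow> (nat \<Rightarrow> nat) \<Rightarrow> nat \<Rightarrow> bool" where
  "minimal_alive n E \<pi> v \<longleftrightarrow> \<pi> v = 0 \<and> (\<forall>u<n. \<pi> u = 0 \<longrightarrow>
     (\<Sum>x<n. of_bool (E v x \<and> \<pi> x = 0)) \<le> (\<Sum>x<n. of_bool (E u x \<and> \<pi> x = (0::nat)) :: nat))"

definition sample_bound :: "nat \<Rightarrow> nat \<Rightarrow> nat" where
  "sample_bound k d = k * k * (d + 1)"

text \<open>The range of moduli from \<open>exists_injective_modulus\<close>, for sets of size at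
  most \<open>sample_bound k d\<close>.\<close>

definition modulus_bound :: "nat \<Rightarrow> nat \<Rightarrow> nat \<Rightarrow> nat" where
  "modulus_bound l k d = 2 * (l * (sample_bound k d * sample_bound k d) + 1)"

section \<open>Values and running times of the pieces\<close>

lemma log_upto_le: "log_upto n i \<le> i"
  by (induction i) auto

text \<open>\<open>\<pi>\<close> is whatever \<open>pos\<close> currently contains: an unfinished
  ordering during the peeling, the finished one during the search.\<close>

locale grundy_machine = time_base +
  fixes n k :: nat and E :: "nat \<Rightarrow> nat \<Rightarrow> bool" and \<pi> :: "nat \<Rightarrow> nat"
  assumes input: "A ''n'' 0 = n" "A ''k'' 0 = k" "\<And>v. A ''pos'' v = \<pi> v"
      "\<And>u v. u < n \<Longrightarrow> v < n \<Longrightarrow> A ''adj'' (u * n + v) \<noteq> 0 \<longleftrightarrow> E u v"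
    and n_le: "n \<le> M"
begin

lemma evals_num_vertices: "evals w num_vertices n 5"
  using evals_get[OF evals_con, of "''n''" w 0] by (simp add: num_vertices_def input)

lemma evals_num_colors: "evals w num_colors k 5"
  using evals_get[OF evals_con, of "''k''" w 0] by (simp add: num_colors_def input)

lemma evals_pos: "evals w a v i \<Longrightarrow> evals w (pos a) (\<pi> v) (i + 3)"
  using evals_get[of w a v i "''pos''"] by (simp add: pos_def input)

lemma evals_edge:
  assumes "evals w a u i" "u < n" "evals w b v j" "v < n"
  shows "evals w (edge a b) (of_bool (E u v)) (i + j + 40)"
  unfolding edge_def
  using assms n_le input(4)[OF assms(2,4)]
  by (intro evals_cong[OF evals_nonzero[OF evals_get[OF evals_add[OF
      evals_mul[OF assms(1) _ evals_num_vertices] assms(3)]]]]) auto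

lemma evals_alive: "evals w a v i \<Longrightarrow> evals w (alive a) (of_bool (\<pi> v = 0)) (2 * i + 40)"
  unfolding alive_def
  by (rule evals_cong, (assumption | rule evals_intros evals_pos)+) auto

lemma evals_alive_degree:
  assumes "evals w a v i" "v < n"
  shows "evals w (alive_degree a) (\<Sum>u<n. of_bool (E v u \<and> \<pi> u = 0)) (i + 200)"
  unfolding alive_degree_def
  by (rule evals_cong, (assumption | rule assms n_le evals_edge evals_alive evals_intros evals_num_vertices
      | (rule evals_mono, assumption))+) auto

lemma evals_select: "evals w select (last_value (minimal_alive n E \<pi>) (\<lambda>v. v) n) 1000"
  unfolding select_def minimal_alive_def
  by (rule evals_cong, (assumption | rule n_le evals_alive evals_alive_degree evals_intros evals_num_vertices
      | (rule evals_mono, assumption))+) auto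

lemma evals_later:
  assumes "evals w a u i" "u < n" "evals w b v j" "v < n"
  shows "evals w (later a b) (of_bool (E u v \<and> \<pi> u < \<pi> v)) (2 * i + 2 * j + 80)"
  unfolding later_def
  by (rule evals_cong, (rule assms evals_edge evals_intros evals_pos)+) auto

lemma evals_later_degree: "evals w later_degree (later_degree_max n E \<pi>) 500"
  unfolding later_degree_def later_degree_max_def
  by (rule evals_cong, (assumption | rule n_le evals_later evals_intros evals_num_vertices
      | (rule evals_mono, assumption))+) auto

lemma evals_log_n: "evals w log_n (log_upto n n) 200"
  unfolding log_n_def
proof (rule evals_cong[OF evals_iter[where F = "log_upto n"]])
  show "evals w num_vertices n 5" by (rule evals_num_vertices)
  show "evals w (con 0) (log_upto n 0) 2" using evals_con[of w 0] by simp
  fix i w' x y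
  assume a: "i < n" "evals w' y (log_upto n i) 2"
  have "log_upto n i \<le> M" using log_upto_le[of n i] a(1) n_le by linarith
  then show "evals w' (ite (lt (pow (con 2) y) num_vertices) (add y (con 1)) y) (log_upto n (Suc i)) 100"
    by (intro evals_cong[OF evals_ite[OF evals_lt[OF evals_pow[OF evals_con M2 a(2)] evals_num_vertices]
        evals_add[OF a(2) evals_con] a(2)]]) auto
qed (use n_le in auto)

end

text \<open>The time base of the search. The factor \<open>n + 2\<close> covers loops over vertices,
  the power covers the guesses. Adding 1 to the logarithm keeps it positive, so that
  \<open>sample_bound k d\<close> squared stays below the base also for graphs with at most one
  vertex.\<close>

definition step_bound :: "nat \<Rightarrow> nat \<Rightarrow> nat \<Rightarrow> nat" where
  "step_bound n k d = (n + 2) * modulus_bound (log_upto n n + 1) k d ^ (k * k)"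

locale grundy_search = grundy_machine +
  fixes d :: nat
  assumes k_pos: "k \<ge> 1" and d_def: "d = later_degree_max n E \<pi>"
    and M_ge: "modulus_bound (log_upto n n + 1) k d ^ (k * k) \<le> M"
begin

lemma modulus_bound_le: "modulus_bound (log_upto n n + 1) k d \<le> M"
proof -
  have "1 \<le> modulus_bound (log_upto n n + 1) k d" by (simp add: modulus_bound_def)
  moreover have "k * k > 0" using k_pos by simp
  ultimately have "modulus_bound (log_upto n n + 1) k d \<le> modulus_bound (log_upto n n + 1) k d ^ (k * k)"
    by (intro self_le_power)
  then show ?thesis using M_ge by linarith
qed

lemma sample_bound_sq_le: "sample_bound k d * sample_bound k d \<le> M"
  using modulus_bound_le unfolding modulus_bound_def
  by (simp add: algebra_simps)

lemma sample_bound_le: "sample_bound k d \<le> M"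
  using sample_bound_sq_le by (meson le_square order_trans)

lemma k_sq_le: "k * k \<le> M"
  using sample_bound_le unfolding sample_bound_def by (simp add: algebra_simps)

lemma k_le: "k \<le> M"
  using k_sq_le by (meson le_square order_trans)

lemma log_le: "log_upto n n \<le> M"
  using log_upto_le[of n n] n_le by linarith

lemma evals_k_sq: "evals w (mul num_colors num_colors) (k * k) 25"
  using evals_mul[OF evals_num_colors k_le evals_num_colors] by simp

lemma evals_sample_size: "evals w sample_size (sample_bound k d) 1000"
  unfolding sample_size_def sample_bound_def d_def
  by (rule evals_cong[OF evals_mul[OF evals_k_sq k_sq_le evals_add[OF evals_later_degree evals_con]]]) auto

lemma evals_max_modulus: "evals w max_modulus (modulus_bound (log_upto n n) k d) 3000"
  unfolding max_modulus_def modulus_bound_def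
  by (rule evals_cong[OF evals_mul[OF evals_con M2 evals_add[OF evals_mul[OF evals_log_n log_le
      evals_mul[OF evals_sample_size sample_bound_le evals_sample_size]] evals_con]]]) auto

text \<open>Exponent 8 is the cost of the modulus \<open>add x (con 1)\<close>; exponent 2 is that
  of a loop variable.\<close>

lemma evals_color:
  assumes q: "evals w q qv 8" "qv > 0" "qv \<le> M" and N: "evals w N Nv 2" "Nv \<le> M"
    and a: "evals w a v 2" "v < n"
  shows "evals w (color q N a) (hash_color k qv Nv v) 5000"
proof -
  have p: "p \<le> M" if "p < k * k" for p using that k_sq_le by linarith
  have v: "v \<le> M" using a n_le by linarith
  have k: "k > 0" using k_pos by simp
  have N': "Nv div x \<le> M" for x using N(2) by (meson div_le_dividend order_trans)
  show ?thesis unfolding color_def hash_color_def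
    by (rule evals_cong, (assumption | rule assms v N' k zero_less_power k_sq_le evals_k_sq evals_num_colors evals_intros
      | erule p | (rule evals_mono, assumption))+) auto
qed

lemma evals_kept:
  assumes q: "evals w q qv 8" "qv > 0" "qv \<le> M" and N: "evals w N Nv 2" "Nv \<le> M"
    and a: "evals w a v 2" "v < n"
  shows "evals w (kept q N a) (of_bool (kept_vertex n E \<pi> (hash_color k qv Nv) v)) 100000"
proof -
  have F: "evals w' (con 0) (of_bool False) 2" for w' using evals_con[of w' 0] by simp
  show ?thesis unfolding kept_def kept_vertex_def
  by (rule evals_cong, (assumption | rule assms n_le F evals_num_vertices evals_color evals_later
       evals_nonzero evals_conj evals_imp evals_all_below evals_eqc
      | (rule evals_mono, assumption))+) auto
qed

lemma evals_witnessed: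
  assumes q: "evals w q qv 8" "qv > 0" "qv \<le> M" and N: "evals w N Nv 2" "Nv \<le> M"
  shows "evals w (witnessed q N) (of_bool (all_witnessed n k E \<pi> (hash_color k qv Nv))) 1000000"
proof -
  have i: "i \<le> M" if "i < k" for i using that k_le by linarith
  show ?thesis unfolding witnessed_def all_witnessed_def
  by (rule evals_cong, (assumption | rule assms n_le i k_le evals_num_vertices evals_num_colors evals_color
       evals_kept evals_edge evals_con evals_add
       evals_nonzero evals_conj evals_imp evals_all_below evals_ex_below evals_eqc
      | (rule evals_mono, assumption))+) auto
qed

lemma evals_answer:
  "evals w answer (of_bool (\<exists>q<modulus_bound (log_upto n n) k d. \<exists>N<(q + 1) ^ (k * k).
     all_witnessed n k E \<pi> (hash_color k (q + 1) N))) 2000000"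
proof -
  have Q: "modulus_bound (log_upto n n) k d \<le> modulus_bound (log_upto n n + 1) k d"
    by (simp add: modulus_bound_def)
  have q: "q + 1 \<le> M" if "q < modulus_bound (log_upto n n) k d" for q
    using that Q modulus_bound_le by linarith
  \<comment> \<open>The guess loop is the longest one; \<open>M_ge\<close> is there to bound
    it.\<close>
  have N: "(q + 1) ^ (k * k) \<le> M" if "q < modulus_bound (log_upto n n) k d" for q
  proof -
    have "(q + 1) ^ (k * k) \<le> modulus_bound (log_upto n n + 1) k d ^ (k * k)"
      using that Q by (intro power_mono) auto
    then show ?thesis using M_ge by linarith
  qed
  have q1: "evals w' (add x (con 1)) (q + 1) 8" if "evals w' x q 2" for w' x q
    using evals_add[OF that evals_con, of 1] by simp
  have Nle: "N \<le> M" if "q < modulus_bound (log_upto n n) k d" "N < (q + 1) ^ (k * k)" for q N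
    using N[OF that(1)] that(2) by linarith
  have Q': "modulus_bound (log_upto n n) k d \<le> M" using Q modulus_bound_le by linarith
  have pos: "0 < q + (1::nat)" for q by simp
  show ?thesis unfolding answer_def
    by (rule evals_cong, (assumption | rule Q' N q q1 pos k_sq_le evals_max_modulus evals_witnessed
       evals_k_sq evals_pow evals_ex_below | (erule Nle, assumption)
      | (rule evals_mono, assumption))+) auto
qed

end

section \<open>Correctness\<close>

lemma log_upto_lower: "n \<le> 2 ^ log_upto n n"
proof -
  \<comment> \<open>Either the exponent has grown in every round or it has reached its goal;
    \<open>n\<close> rounds of growth suffice as well, because \<open>n < 2 ^ n\<close>.\<close>
  have "log_upto n i = i \<or> n \<le> 2 ^ log_upto n i" for i
    by (induction i) auto
  from this[of n] show ?thesis by (metis less_exp less_imp_le)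
qed

lemma log_upto_upper: "2 ^ log_upto n i \<le> 2 * max 1 n"
  by (induction i) auto

lemma last_value_cases:
  "(\<exists>p<i. P p \<and> last_value P g i = g p) \<or> last_value P g i = 0 \<and> (\<forall>p<i. \<not> P p)"
  by (induction i) (auto simp: less_Suc_eq)

lemma hash_color_le: "hash_color k q N v \<le> k"
proof -
  have "p div k + 1 \<le> k" if "p < k * k" for p
    using that by (simp add: Suc_leI less_mult_imp_div_less)
  then show ?thesis
    using last_value_cases[of "k * k" "\<lambda>p. N div q ^ p mod q = v mod q" "\<lambda>p. p div k + 1"]
    unfolding hash_color_def by fastforce
qed

text \<open>Soundness for an arbitrary guess: injectivity of \<open>\<pi>\<close> orients every
  edge, and if both ends had the same color, the earlier one would not have been kept. The kept
  vertices are then completed greedily.\<close>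

lemma all_witnessed_imp_has_partial_grundy_coloring:
  assumes G: "pair_graph G" and V: "pverts G = {0..<n}" and inj: "inj_on \<pi> {..<n}"
    and le: "\<And>v. f v \<le> k"
    and wit: "all_witnessed n k (\<lambda>u v. (u, v) \<in> parcs G) \<pi> f"
  shows "has_partial_grundy_coloring G k"
proof -
  interpret pair_graph G by (fact G)
  let ?E = "\<lambda>u v. (u, v) \<in> parcs G"
  let ?kept = "kept_vertex n ?E \<pi> f"
  define S where "S = {v. v < n \<and> ?kept v}"
  show ?thesis
  proof (rule has_partial_grundy_coloring_extend[OF G, of S f])
    show "S \<subseteq> pverts G" unfolding V S_def by auto
    show "\<forall>v\<in>S. f v \<in> {1..k}" using le by (auto simp: S_def kept_vertex_def)
    show "\<forall>(u, v)\<in>parcs G. u \<in> S \<longrightarrow> v \<in> S \<longrightarrow> f u \<noteq> f v"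
    proof clarify
      fix u v assume uv: "(u, v) \<in> parcs G" "u \<in> S" "v \<in> S" "f u = f v"
      have "(v, u) \<in> parcs G" using uv(1) by (metis arcs_symmetric)
      moreover have "u \<noteq> v" using uv(1) by (metis no_loops')
      then have "\<pi> u \<noteq> \<pi> v" using inj uv(2,3) by (auto simp: S_def inj_on_def)
      ultimately show False using uv by (auto simp: S_def kept_vertex_def neq_iff)
    qed
    show "\<forall>i\<in>{1..k}. \<exists>v\<in>S. f v = i \<and> (\<forall>j\<in>{1..i - 1}. \<exists>u\<in>S. (v, u) \<in> parcs G \<and> f u = j)"
    proof
      fix i assume i: "i \<in> {1..k}"
      then have "i - 1 < k" by auto
      then obtain v where v: "v < n" "?kept v" "f v = i - 1 + 1"
        "\<forall>j<i - 1. \<exists>u<n. (v, u) \<in> parcs G \<and> ?kept u \<and> f u = j + 1"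
        using wit unfolding all_witnessed_def by blast
      have "\<exists>u\<in>S. (v, u) \<in> parcs G \<and> f u = j" if "j \<in> {1..i - 1}" for j
      proof -
        have "j - 1 < i - 1" "j - 1 + 1 = j" using that by auto
        then show ?thesis using v(4)[rule_format, of "j - 1"] by (auto simp: S_def)
      qed
      moreover have "v \<in> S" "f v = i" using v i by (auto simp: S_def)
      ultimately show "\<exists>v\<in>S. f v = i \<and> (\<forall>j\<in>{1..i - 1}. \<exists>u\<in>S. (v, u) \<in> parcs G \<and> f u = j)" by blast
    qed
  qed
qed

lemma sum_of_bool_below: "(\<Sum>x<n. of_bool (P x)) = card {x. x < (n::nat) \<and> P x}"
proof -
  have "{x. x < n \<and> P x} = {..<n} \<inter> {x. P x}" by auto
  then show ?thesis by (simp add: sum_of_bool_eq)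
qed

lemma card_later_le:
  assumes "v < n"
  shows "card {u. u < n \<and> E v u \<and> \<pi> v < \<pi> u} \<le> later_degree_max n E \<pi>"
  using assms unfolding later_degree_max_def sum_of_bool_below by (intro Max_ge) auto

text \<open>Completeness: if the residues of the witness and its out-neighbors are distinct, the
  guess that lists the residues of the witness colors exactly the witness within that set.\<close>

lemma exists_hash_witness:
  assumes V: "pverts G = {0..<n}"
    and c: "partial_grundy_coloring G k' c" and k: "k \<le> k'" "k \<ge> 1"
    and d: "d = later_degree_max n (\<lambda>u v. (u, v) \<in> parcs G) \<pi>" and L: "n \<le> 2 ^ L"
  shows "\<exists>q<modulus_bound L k d. \<exists>N<(q + 1) ^ (k * k).
     all_witnessed n k (\<lambda>u v. (u, v) \<in> parcs G) \<pi> (hash_color k (q + 1) N)"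
proof -
  let ?E = "\<lambda>u v. (u, v) \<in> parcs G"
  have proper: "c u \<noteq> c v" if "(u, v) \<in> parcs G" for u v
    using c that unfolding partial_grundy_coloring_def proper_coloring_def by auto
  have "\<forall>i\<in>{1..k}. \<exists>v. v < n \<and> c v = i \<and> (\<forall>j\<in>{1..i - 1}. \<exists>u<n. (v, u) \<in> parcs G \<and> c u = j)"
  proof
    fix i assume "i \<in> {1..k}"
    then have "i \<in> {1..k'}" using k(1) by simp
    then obtain v where "v < n" "c v = i" "\<forall>j\<in>{1..i - 1}. \<exists>u\<in>{0..<n}. (v, u) \<in> parcs G \<and> c u = j"
      using c unfolding partial_grundy_coloring_def V by fastforce
    then show "\<exists>v. v < n \<and> c v = i \<and> (\<forall>j\<in>{1..i - 1}. \<exists>u<n. (v, u) \<in> parcs G \<and> c u = j)"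
      by (intro exI[of _ v]) (simp add: Bex_def)
  qed
  from bchoice[OF this] obtain z where z: "\<And>i. i \<in> {1..k} \<Longrightarrow> z i < n"
      "\<And>i. i \<in> {1..k} \<Longrightarrow> c (z i) = i"
      "\<And>i j. i \<in> {1..k} \<Longrightarrow> j \<in> {1..i - 1} \<Longrightarrow> \<exists>u<n. (z i, u) \<in> parcs G \<and> c u = j"
    by blast
  \<comment> \<open>\<open>z i\<close> is the center of color \<open>i\<close>, and
    \<open>y i j\<close> its neighbor of color \<open>j\<close>. Only the first \<open>k\<close> of
    the \<open>k'\<close> colors are used.\<close>
  define y where "y i j = (SOME u. u < n \<and> (z i, u) \<in> parcs G \<and> c u = j)" for i j
  have y: "y i j < n \<and> (z i, y i j) \<in> parcs G \<and> c (y i j) = j"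
    if "i \<in> {1..k}" "j \<in> {1..i - 1}" for i j
    unfolding y_def by (rule someI_ex) (rule z(3)[OF that])
  \<comment> \<open>Position \<open>p\<close> carries a vertex of color \<open>p div k + 1\<close>: the neighbor serving the
    center of color \<open>p mod k + 1\<close>, or the center of its own color.\<close>
  define x where "x p = (if p div k < p mod k then y (p mod k + 1) (p div k + 1) else z (p div k + 1))" for p
  have x: "x p < n \<and> c (x p) = p div k + 1" if "p < k * k" for p
  proof -
    have "p div k < k" using that by (rule less_mult_imp_div_less)
    moreover have "p mod k < k" using k by simp
    ultimately have in_k: "p div k + 1 \<in> {1..k}" "p mod k + 1 \<in> {1..k}"
      by (simp_all add: Suc_le_eq)
    show ?thesis
    proof (cases "p div k < p mod k")
      case True
      then have "p div k + 1 \<in> {1..p mod k + 1 - 1}" by simp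
      from y[OF in_k(2) this] True show ?thesis by (simp add: x_def)
    next
      case False
      with z(1,2)[OF in_k(1)] show ?thesis by (simp add: x_def)
    qed
  qed
  define W where "W = x ` {..<k * k}"
  define S where "S = W \<union> (\<Union>v\<in>W. {u. u < n \<and> ?E v u \<and> \<pi> v < \<pi> u})"
  have finW: "finite W" by (simp add: W_def)
  have Wn: "v < n" if "v \<in> W" for v using that x by (auto simp: W_def)
  have cardW: "card W \<le> k * k" unfolding W_def by (metis card_image_le card_lessThan finite_lessThan)
  have "card S \<le> card W + card (\<Union>v\<in>W. {u. u < n \<and> ?E v u \<and> \<pi> v < \<pi> u})"
    unfolding S_def by (rule card_Un_le)
  also have "\<dots> \<le> card W + (\<Sum>v\<in>W. card {u. u < n \<and> ?E v u \<and> \<pi> v < \<pi> u})"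
    using card_UN_le[OF finW] by simp
  also have "\<dots> \<le> card W + (\<Sum>v\<in>W. d)"
    unfolding d using Wn by (intro add_left_mono sum_mono card_later_le) auto
  also have "\<dots> = card W * (d + 1)" by simp
  also have "\<dots> \<le> sample_bound k d" unfolding sample_bound_def by (rule mult_right_mono[OF cardW]) simp
  finally have "card S \<le> sample_bound k d" .
  moreover have "S \<subseteq> {..<n}" using Wn by (auto simp: S_def)
  ultimately obtain q where q: "q \<in> {1..modulus_bound L k d}" "inj_on (\<lambda>x. x mod q) S"
    using exists_injective_modulus[OF _ _ L] unfolding modulus_bound_def by blast
  then have "q > 0" by simp
  then obtain N where N: "N < q ^ (k * k)" "\<And>p. p < k * k \<Longrightarrow> N div q ^ p mod q = x p mod q"
    using digits_exist[of "k * k" "\<lambda>p. x p mod q" q] by auto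
  define f where "f = hash_color k q N"
  \<comment> \<open>Inside \<open>S\<close> hashing is faithful: a vertex matches digit
    \<open>p\<close> only if it is the vertex at position \<open>p\<close>.\<close>
  have eq: "N div q ^ p mod q = v mod q \<longleftrightarrow> x p = v" if "p < k * k" "v \<in> S" for p v
  proof -
    have "x p \<in> S" using that by (auto simp: S_def W_def)
    then show ?thesis using N(2)[OF that(1)] that(2) q(2) by (auto dest: inj_onD)
  qed
  \<comment> \<open>A vertex may occupy several positions, but each of them carries its color
    \<open>c v\<close>, so taking the last match is harmless. Vertices of \<open>S\<close> outside
    \<open>W\<close> match no position.\<close>
  have f: "f v = (if v \<in> W then c v else 0)" if "v \<in> S" for v
  proof -
    have "(\<exists>p<k * k. x p = v \<and> f v = p div k + 1) \<or> f v = 0 \<and> (\<forall>p<k * k. x p \<noteq> v)"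
      using last_value_cases[of "k * k" "\<lambda>p. N div q ^ p mod q = v mod q" "\<lambda>p. p div k + 1"]
        eq[OF _ that]
      unfolding f_def hash_color_def by blast
    then show ?thesis
    proof
      assume "\<exists>p<k * k. x p = v \<and> f v = p div k + 1"
      then obtain p where "p < k * k" "x p = v" "f v = p div k + 1" by blast
      with x[of p] show ?thesis by (simp add: W_def) blast
    next
      assume "f v = 0 \<and> (\<forall>p<k * k. x p \<noteq> v)"
      then show ?thesis by (auto simp: W_def)
    qed
  qed
  have WS: "v \<in> S" if "v \<in> W" for v using that by (auto simp: S_def)
  have kept: "kept_vertex n ?E \<pi> f v" if v: "v \<in> W" for v
    unfolding kept_vertex_def
  proof (intro conjI allI impI)
    have "c v \<noteq> 0" using v x by (auto simp: W_def)
    then show fv: "f v \<noteq> 0" using f[OF WS[OF v]] v by simp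
    fix u assume u: "u < n" "(v, u) \<in> parcs G \<and> \<pi> v < \<pi> u"
    \<comment> \<open>Hence \<open>f u\<close> is either \<open>c u\<close> or \<open>0\<close>, and
      neither equals \<open>c v\<close>.\<close>
    then have "u \<in> S" using v by (auto simp: S_def)
    moreover have "c v \<noteq> c u" using u(2) proper by blast
    ultimately show "f u \<noteq> f v" using f[of u] f[OF WS[OF v]] v fv by (simp split: if_splits)
  qed
  have xW: "x p \<in> W" if "p < k * k" for p using that by (auto simp: W_def)
  have fW: "f (x p) = p div k + 1" if "p < k * k" for p
    using f[OF WS[OF xW[OF that]]] xW[OF that] x[OF that] by simp
  have idx: "j * k + i < k * k" "(j * k + i) div k = j" "(j * k + i) mod k = i"
    if "i < k" "j < k" for i j
  proof -
    have "j * k + i < Suc j * k" using that by simp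
    also have "\<dots> \<le> k * k" using that by (intro mult_right_mono) auto
    finally show "j * k + i < k * k" .
  qed (use that in auto)
  have "all_witnessed n k ?E \<pi> f"
    unfolding all_witnessed_def
  proof (intro allI impI)
    fix i assume i: "i < k"
    have k0: "0 < k" using k by simp
    \<comment> \<open>Position \<open>i * k\<close> has remainder 0, so it carries the center of
      color \<open>i + 1\<close>; position \<open>j * k + i\<close> with \<open>j < i\<close>
      carries its neighbor of color \<open>j + 1\<close>.\<close>
    have xi: "x (i * k) = z (i + 1)" using idx(2,3)[OF k0 i] by (simp add: x_def)
    have ik: "i * k < k * k" using idx(1)[OF k0 i] by simp
    have "\<exists>u<n. (x (i * k), u) \<in> parcs G \<and> kept_vertex n ?E \<pi> f u \<and> f u = j + 1"
      if j: "j < i" for j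
    proof -
      have jk: "j < k" using i j by simp
      let ?p = "j * k + i"
      have "x ?p = y (i + 1) (j + 1)" using idx(2,3)[OF i jk] j by (simp add: x_def)
      moreover have "(z (i + 1), y (i + 1) (j + 1)) \<in> parcs G" using y[of "i + 1" "j + 1"] i j by auto
      ultimately show ?thesis
        using idx[OF i jk] x[of ?p] kept[OF xW, of ?p] fW[of ?p] xi by (intro exI[of _ "x ?p"]) auto
    qed
    moreover have "x (i * k) < n" "kept_vertex n ?E \<pi> f (x (i * k))" "f (x (i * k)) = i + 1"
      using x[OF ik] kept[OF xW[OF ik]] fW[OF ik] k by auto
    ultimately show "\<exists>v<n. kept_vertex n ?E \<pi> f v \<and> f v = i + 1 \<and>
        (\<forall>j<i. \<exists>u<n. (v, u) \<in> parcs G \<and> kept_vertex n ?E \<pi> f u \<and> f u = j + 1)"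
      by blast
  qed
  moreover have "q - 1 < modulus_bound L k d" "q - 1 + 1 = q" using q(1) by auto
  ultimately show ?thesis using N(1) unfolding f_def by (intro exI[of _ "q - 1"]) auto
qed

lemma hash_search_correct:
  assumes "pair_graph G" and "pverts G = {0..<n}" and "k \<ge> 1" and "inj_on \<pi> {..<n}"
  shows "(\<exists>q<modulus_bound (log_upto n n) k (later_degree_max n (\<lambda>u v. (u, v) \<in> parcs G) \<pi>).
      \<exists>N<(q + 1) ^ (k * k).
        all_witnessed n k (\<lambda>u v. (u, v) \<in> parcs G) \<pi> (hash_color k (q + 1) N)) \<longleftrightarrow>
    has_partial_grundy_coloring G k"
proof
  let ?E = "\<lambda>u v. (u, v) \<in> parcs G"
  assume "\<exists>q<modulus_bound (log_upto n n) k (later_degree_max n ?E \<pi>). \<exists>N<(q + 1) ^ (k * k).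
    all_witnessed n k ?E \<pi> (hash_color k (q + 1) N)"
  then obtain q N where "all_witnessed n k ?E \<pi> (hash_color k (q + 1) N)" by blast
  with assms hash_color_le show "has_partial_grundy_coloring G k"
    by (intro all_witnessed_imp_has_partial_grundy_coloring)
next
  assume "has_partial_grundy_coloring G k"
  then obtain k' c where "k \<le> k'" "partial_grundy_coloring G k' c"
    unfolding has_partial_grundy_coloring_def by blast
  from exists_hash_witness[OF assms(2) this(2,1) assms(3) refl log_upto_lower]
  show "\<exists>q<modulus_bound (log_upto n n) k (later_degree_max n (\<lambda>u v. (u, v) \<in> parcs G) \<pi>).
    \<exists>N<(q + 1) ^ (k * k).
      all_witnessed n k (\<lambda>u v. (u, v) \<in> parcs G) \<pi> (hash_color k (q + 1) N)" .
qed

section \<open>Degeneracy orderings by peeling\<close>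

text \<open>\<open>\<pi> v = 0\<close> means that \<open>v\<close> has not been removed yet; otherwise \<open>\<pi> v\<close> is the time of its removal.\<close>

definition peeled :: "nat pair_pre_digraph \<Rightarrow> nat \<Rightarrow> nat \<Rightarrow> (nat \<Rightarrow> nat) \<Rightarrow> bool" where
  "peeled G n i \<pi> \<longleftrightarrow> card {v. v < n \<and> \<pi> v = 0} = n - i \<and> (\<forall>v<n. \<pi> v \<le> i) \<and>
     inj_on \<pi> {v. v < n \<and> \<pi> v \<noteq> 0} \<and>
     (\<forall>v<n. \<pi> v \<noteq> 0 \<longrightarrow>
        card {u. u < n \<and> (v, u) \<in> parcs G \<and> (\<pi> u = 0 \<or> \<pi> v < \<pi> u)} \<le> degeneracy G)"

text \<open>Degeneracy is applied to the subgraph induced by \<open>R\<close>, where the out-degree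
  counts the neighbors in \<open>R\<close>.\<close>

lemma exists_alive_low_degree:
  assumes G: "pair_graph G" and R: "R \<subseteq> pverts G" "R \<noteq> {}"
  shows "\<exists>v\<in>R. card {u. u \<in> R \<and> (v, u) \<in> parcs G} \<le> degeneracy G"
proof -
  interpret pair_graph G by (fact G)
  define H where "H = \<lparr>pverts = R, parcs = {(u, v). (u, v) \<in> parcs G \<and> u \<in> R \<and> v \<in> R}\<rparr>"
  have sym: "(v, u) \<in> parcs G" if "(u, v) \<in> parcs G" for u v
    using that by (metis arcs_symmetric)
  have "pair_graph H"
  proof
    show "finite (pverts H)" using finite_subset[OF R(1) pair_finite_verts] by (simp add: H_def)
    show "finite (parcs H)"
      by (rule finite_subset[OF _ pair_finite_arcs]) (auto simp: H_def)
    show "symmetric (with_proj H)"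
      using sym unfolding symmetric_def by (auto simp: H_def intro!: symI simp: arcs_ends_def arc_to_ends_def)
  qed (auto simp: H_def no_loops')
  moreover have "subgraph (with_proj H) (with_proj G)"
    unfolding subgraph_def
  proof (intro conjI)
    interpret H: pair_graph H by fact
    show "wf_digraph (with_proj H)" "wf_digraph (with_proj G)"
      by (simp_all add: wf_digraph_wp_iff H.pair_wf_digraph_axioms pair_wf_digraph_axioms)
  qed (use R(1) in \<open>auto simp: H_def compatible_def\<close>)
  ultimately obtain v where v: "v \<in> pverts H" "out_degree (with_proj H) v \<le> degeneracy G"
    using degenerate_degeneracy[OF G] R(2) unfolding degenerate_def by (force simp: H_def)
  have "out_arcs (with_proj H) v = Pair v ` {u. u \<in> R \<and> (v, u) \<in> parcs G}"
    using v(1) by (auto simp: H_def out_arcs_def)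
  then have "out_degree (with_proj H) v = card {u. u \<in> R \<and> (v, u) \<in> parcs G}"
    unfolding out_degree_def by (simp add: card_image inj_on_def)
  with v show ?thesis by (auto simp: H_def)
qed

lemma peeled_step:
  assumes G: "pair_graph G" and V: "pverts G = {0..<n}" and i: "i < n" and p: "peeled G n i \<pi>"
    and v: "v = last_value (minimal_alive n (\<lambda>u v. (u, v) \<in> parcs G) \<pi>) (\<lambda>v. v) n"
  shows "v < n \<and> peeled G n (Suc i) (\<pi>(v := Suc i))"
proof -
  interpret pair_graph G by (fact G)
  let ?E = "\<lambda>u v. (u, v) \<in> parcs G"
  define R where "R = {v. v < n \<and> \<pi> v = 0}"
  have cardR: "card R = n - i" and pi_le: "\<And>v. v < n \<Longrightarrow> \<pi> v \<le> i"
    and inj: "inj_on \<pi> {v. v < n \<and> \<pi> v \<noteq> 0}"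
    and deg: "\<And>v. v < n \<Longrightarrow> \<pi> v \<noteq> 0 \<Longrightarrow>
      card {u. u < n \<and> ?E v u \<and> (\<pi> u = 0 \<or> \<pi> v < \<pi> u)} \<le> degeneracy G"
    using p by (auto simp: peeled_def R_def)
  have "R \<noteq> {}" using cardR i by (metis card.empty diff_is_0_eq not_less)
  have minimal: "minimal_alive n ?E \<pi> w \<longleftrightarrow> \<pi> w = 0 \<and>
      (\<forall>u\<in>R. card {x. x \<in> R \<and> ?E w x} \<le> card {x. x \<in> R \<and> ?E u x})" for w
  proof -
    have "{x. x < n \<and> ?E u x \<and> \<pi> x = 0} = {x. x \<in> R \<and> ?E u x}" for u by (auto simp: R_def)
    then show ?thesis unfolding minimal_alive_def sum_of_bool_below by (simp add: R_def imp_conjL)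
  qed
  \<comment> \<open>Some vertex passes the test of the selection, so \<open>v\<close> is a genuine
    choice and not the default \<open>0\<close> of \<open>last_value\<close>.\<close>
  define w where "w = arg_min (\<lambda>w. card {x. x \<in> R \<and> ?E w x}) (\<lambda>w. w \<in> R)"
  have w: "w \<in> R" "\<And>u. u \<in> R \<Longrightarrow> card {x. x \<in> R \<and> ?E w x} \<le> card {x. x \<in> R \<and> ?E u x}"
  proof -
    obtain r where "r \<in> R" using \<open>R \<noteq> {}\<close> by blast
    then show "w \<in> R" unfolding w_def by (rule arg_min_natI)
    show "card {x. x \<in> R \<and> ?E w x} \<le> card {x. x \<in> R \<and> ?E u x}" if "u \<in> R" for u
      unfolding w_def using that by (rule arg_min_nat_le)
  qed
  have "minimal_alive n ?E \<pi> w" "w < n" using w minimal by (auto simp: R_def)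
  then have vn: "v < n" and vmin: "minimal_alive n ?E \<pi> v"
    using last_value_cases[of n "minimal_alive n ?E \<pi>" "\<lambda>v. v"] unfolding v[symmetric] by auto
  have vR: "v \<in> R" using vn vmin minimal by (auto simp: R_def)
  have vdeg: "card {x. x \<in> R \<and> ?E v x} \<le> degeneracy G"
  proof -
    have "R \<subseteq> pverts G" unfolding V R_def by auto
    then obtain u where "u \<in> R" "card {x. x \<in> R \<and> ?E u x} \<le> degeneracy G"
      using exists_alive_low_degree[OF G _ \<open>R \<noteq> {}\<close>] by blast
    with vmin minimal show ?thesis by fastforce
  qed
  let ?\<pi> = "\<pi>(v := Suc i)"
  have "{u. u < n \<and> ?\<pi> u = 0} = R - {v}" by (auto simp: R_def)
  then have "card {u. u < n \<and> ?\<pi> u = 0} = n - Suc i" using cardR vR by simp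
  moreover have "\<forall>u<n. ?\<pi> u \<le> Suc i" using pi_le by (simp add: le_SucI)
  moreover have "inj_on ?\<pi> {u. u < n \<and> ?\<pi> u \<noteq> 0}"
  proof (rule inj_onI)
    fix a b
    assume ab: "a \<in> {u. u < n \<and> ?\<pi> u \<noteq> 0}" "b \<in> {u. u < n \<and> ?\<pi> u \<noteq> 0}" "?\<pi> a = ?\<pi> b"
    then have "a = v \<longleftrightarrow> b = v" using pi_le[of a] pi_le[of b] by (auto split: if_splits)
    then show "a = b" using ab inj_onD[OF inj, of a b] by (cases "a = v") auto
  qed
  moreover have "card {x. x < n \<and> ?E u x \<and> (?\<pi> x = 0 \<or> ?\<pi> u < ?\<pi> x)} \<le> degeneracy G"
    if u: "u < n" "?\<pi> u \<noteq> 0" for u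
  proof (cases "u = v")
    case True
    \<comment> \<open>The new stamp \<open>Suc i\<close> exceeds all earlier ones, so only remaining
      vertices can come after \<open>v\<close>.\<close>
    have "{x. x < n \<and> ?E u x \<and> (?\<pi> x = 0 \<or> ?\<pi> u < ?\<pi> x)} \<subseteq> {x. x \<in> R \<and> ?E v x}"
    proof
      fix x assume x: "x \<in> {x. x < n \<and> ?E u x \<and> (?\<pi> x = 0 \<or> ?\<pi> u < ?\<pi> x)}"
      then have "x \<noteq> v" using True by auto
      then show "x \<in> {x. x \<in> R \<and> ?E v x}" using x True pi_le[of x] by (auto simp: R_def)
    qed
    from card_mono[OF _ this] show ?thesis using vdeg by (simp add: R_def)
  next
    case False
    \<comment> \<open>For a vertex removed earlier, \<open>v\<close> merely moves from still present
      to removed later; it is counted either way.\<close>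
    have "{x. x < n \<and> ?E u x \<and> (?\<pi> x = 0 \<or> ?\<pi> u < ?\<pi> x)} =
        {x. x < n \<and> ?E u x \<and> (\<pi> x = 0 \<or> \<pi> u < \<pi> x)}"
      using False vR pi_le[OF u(1)] by (auto simp: R_def)
    then show ?thesis using deg[OF u(1)] u(2) False by simp
  qed
  ultimately show ?thesis using vn unfolding peeled_def by blast
qed

lemma peeled_0: "peeled G n 0 (\<lambda>_. 0)"
  by (simp add: peeled_def)

lemma peeled_all:
  assumes "peeled G n n \<pi>"
  shows "inj_on \<pi> {..<n}" and "later_degree_max n (\<lambda>u v. (u, v) \<in> parcs G) \<pi> \<le> degeneracy G"
proof -
  have "{v. v < n \<and> \<pi> v = 0} = {}" using assms by (simp add: peeled_def)
  then have nz: "\<pi> v \<noteq> 0" if "v < n" for v using that by auto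
  then have "{v. v < n \<and> \<pi> v \<noteq> 0} = {..<n}" by auto
  then show "inj_on \<pi> {..<n}" using assms by (simp add: peeled_def)
  have "card {u. u < n \<and> (v, u) \<in> parcs G \<and> \<pi> v < \<pi> u} \<le> degeneracy G" if "v < n" for v
  proof -
    have "card {u. u < n \<and> (v, u) \<in> parcs G \<and> \<pi> v < \<pi> u} \<le>
        card {u. u < n \<and> (v, u) \<in> parcs G \<and> (\<pi> u = 0 \<or> \<pi> v < \<pi> u)}"
      by (rule card_mono) auto
    also have "\<dots> \<le> degeneracy G" using assms nz[OF that] that unfolding peeled_def by blast
    finally show ?thesis .
  qed
  then show "later_degree_max n (\<lambda>u v. (u, v) \<in> parcs G) \<pi> \<le> degeneracy G"
    unfolding later_degree_max_def sum_of_bool_below by (intro Max.boundedI) auto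
qed

section \<open>Running time\<close>

definition peel_body :: program where
  "peel_body = Seq (select 0)
     (Seq (Store ''pos'' (slot 0) (Add (Load ''step'' (Const 0)) (Const 1)))
       (Store ''step'' (Const 0) (Add (Load ''step'' (Const 0)) (Const 1))))"

definition peel :: program where
  "peel = While (Sub (Load ''n'' (Const 0)) (Load ''step'' (Const 0))) peel_body"

definition grundy_program :: program where
  "grundy_program = Seq peel (Seq (answer 0) (Store ''out'' (Const 0) (slot 0)))"

definition holds_input :: "nat pair_pre_digraph \<Rightarrow> nat \<Rightarrow> nat \<Rightarrow> memory \<Rightarrow> bool" where
  "holds_input G n k m \<longleftrightarrow> m ''n'' 0 = n \<and> m ''k'' 0 = k \<and>
     (\<forall>u<n. \<forall>v<n. m ''adj'' (u * n + v) \<noteq> 0 \<longleftrightarrow> (u, v) \<in> parcs G)"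

lemma holds_input_pgc_input: "holds_input G n k (pgc_input G n k)"
  unfolding holds_input_def pgc_input_def by auto

text \<open>The time base is \<open>n + 2\<close>: the base of the search depends on the out-degree
  of the finished ordering, which does not exist yet.\<close>

lemma runs_peel:
  assumes G: "pair_graph G" and V: "pverts G = {0..<n}"
    and "holds_input G n k m" "m ''step'' 0 = i" "peeled G n i (m ''pos'')" "i \<le> n"
  shows "\<exists>t m'. runs peel m t m' \<and> t \<le> (n - i) * ((n + 2) ^ 1000 + 31) + 6 \<and>
    holds_input G n k m' \<and> peeled G n n (m' ''pos'')"
  using assms(3-)
proof (induction "n - i" arbitrary: i m)
  case 0
  then have "runs peel m 6 m" unfolding peel_def
    by (intro runs_cong[OF runs.WhileFalse]) (auto simp: holds_input_def)
  then show ?case using 0 by (intro exI[of _ 6] exI[of _ m]) auto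
next
  case (Suc r)
  let ?E = "\<lambda>u v. (u, v) \<in> parcs G"
  have i: "i < n" using Suc.hyps(2) by simp
  \<comment> \<open>Evaluation is relative to fixed arrays, so each round instantiates it anew with
    the current \<open>pos\<close>.\<close>
  interpret grundy_machine "n + 2" m n k ?E "m ''pos''"
    by unfold_locales (use Suc.prems(1) in \<open>auto simp: holds_input_def\<close>)
  define v where "v = last_value (minimal_alive n ?E (m ''pos'')) (\<lambda>v. v) n"
  have v: "v < n" "peeled G n (Suc i) ((m ''pos'')(v := Suc i))"
    using peeled_step[OF G V i Suc.prems(3) v_def] by auto
  have "agrees m" by (simp add: agrees_def)
  with evals_select[of "(0, m)"] world_le_refl obtain t m1
    where 1: "runs (select 0) m t m1" "t \<le> (n + 2) ^ 1000" "m1 stk 0 = v" "frame 0 m m1"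
    unfolding v_def by (rule evalsE)
  have same: "m1 x = m x" if "x \<noteq> stk" for x using 1(4) that by (simp add: frame_def)
  \<comment> \<open>The stamp is the step counter plus 1, since \<open>0\<close> marks the remaining
    vertices.\<close>
  define m2 where "m2 = m1(''pos'' := (m1 ''pos'')(v := Suc i))"
  define m3 where "m3 = m2(''step'' := (m2 ''step'')(0 := Suc i))"
  have "runs (Store ''pos'' (slot 0) (Add (Load ''step'' (Const 0)) (Const 1))) m1 7 m2"
    using runs_cong[OF runs.Store[of "''pos''" "slot 0" "Add (Load ''step'' (Const 0)) (Const 1)" m1], of 7]
      1(3) Suc.prems(2) by (simp add: m2_def same)
  moreover have "runs (Store ''step'' (Const 0) (Add (Load ''step'' (Const 0)) (Const 1))) m2 6 m3"
    using runs_cong[OF runs.Store[of "''step''" "Const 0" "Add (Load ''step'' (Const 0)) (Const 1)" m2], of 6]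
      Suc.prems(2) by (simp add: m2_def m3_def same)
  ultimately have body: "runs peel_body m (1 + t + (1 + 7 + 6)) m3"
    unfolding peel_body_def using 1(1) by (intro runs.Seq)
  have "r = n - Suc i" "Suc i \<le> n" using Suc.hyps(2) i by simp_all
  moreover have "holds_input G n k m3" "m3 ''step'' 0 = Suc i" "m3 ''pos'' = (m ''pos'')(v := Suc i)"
    using Suc.prems(1) by (simp_all add: holds_input_def m2_def m3_def same)
  ultimately obtain t' m' where R: "runs peel m3 t' m'"
      "t' \<le> (n - Suc i) * ((n + 2) ^ 1000 + 31) + 6" "holds_input G n k m'" "peeled G n n (m' ''pos'')"
    using Suc.hyps(1)[of "Suc i" m3] v(2) by auto
  have "eval_expr (Sub (Load ''n'' (Const 0)) (Load ''step'' (Const 0))) m \<noteq> 0"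
    using Suc.prems(1,2) i by (simp add: holds_input_def)
  from runs.WhileTrue[OF this body R(1)[unfolded peel_def]]
  have "runs peel m (1 + 5 + (1 + t + (1 + 7 + 6)) + t') m'" unfolding peel_def
    by (rule runs_cong) simp
  moreover have "1 + 5 + (1 + t + (1 + 7 + 6)) + t' \<le> (n - i) * ((n + 2) ^ 1000 + 31) + 6"
  proof -
    have "n - i = Suc (n - Suc i)" using i by simp
    then have "(n - i) * ((n + 2) ^ 1000 + 31) =
        (n + 2) ^ 1000 + 31 + (n - Suc i) * ((n + 2) ^ 1000 + 31)" by (simp only: mult_Suc)
    then show ?thesis using 1(2) R(2) by linarith
  qed
  ultimately show ?case using R(3,4) by blast
qed

text \<open>The exponent of \<open>answer\<close>, plus 10 for the factor 1024 that covers the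
  peeling and the remaining steps.\<close>

definition time_exponent :: nat where "time_exponent = 2000000 + 10"

lemma step_bound_ge: "n + 2 \<le> step_bound n k d" and
  step_bound_ge_power: "modulus_bound (log_upto n n + 1) k d ^ (k * k) \<le> step_bound n k d"
proof -
  have "1 \<le> modulus_bound (log_upto n n + 1) k d ^ (k * k)" by (simp add: modulus_bound_def)
  from mult_le_mono2[OF this, of "n + 2"] show "n + 2 \<le> step_bound n k d"
    unfolding step_bound_def by simp
  show "modulus_bound (log_upto n n + 1) k d ^ (k * k) \<le> step_bound n k d"
    unfolding step_bound_def by simp
qed

lemma (in time_base) combined_time:
  assumes n: "n \<le> M" and t1: "t1 \<le> n * (a + 31) + 6" and a: "a \<le> M ^ i" and t2: "t2 \<le> M ^ j"
    and ij: "i < j"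
  shows "1 + t1 + (1 + t2 + 4) \<le> M ^ (j + 10)"
proof -
  have "n * (a + 31) \<le> M * (32 * M ^ i)" using n a power_pos[of i] by (intro mult_mono) auto
  also have "\<dots> = 32 * M ^ Suc i" by simp
  also have "\<dots> \<le> 32 * M ^ j" using ij by (intro mult_left_mono power_le) auto
  finally have "1 + t1 + (1 + t2 + 4) \<le> 1024 * M ^ j" using t1 t2 power_pos[of j] by linarith
  also have "\<dots> \<le> M ^ 10 * M ^ j" by (intro mult_right_mono const_le_power) auto
  finally show ?thesis by (simp add: power_add mult.commute)
qed

lemma runs_grundy_program:
  assumes G: "pair_graph G" and V: "pverts G = {0..<n}" and k: "k \<ge> 1"
  shows "\<exists>t m d. runs grundy_program (pgc_input G n k) t m \<and> d \<le> degeneracy G \<and>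
    m ''out'' 0 = (if has_partial_grundy_coloring G k then 1 else 0) \<and>
    t \<le> step_bound n k d ^ time_exponent"
proof -
  let ?E = "\<lambda>u v. (u, v) \<in> parcs G"
  let ?m = "pgc_input G n k"
  have "?m ''step'' 0 = 0" by (simp add: pgc_input_def)
  moreover have "peeled G n 0 (?m ''pos'')" using peeled_0 by (simp add: pgc_input_def)
  ultimately obtain t1 m1 where 1: "runs peel ?m t1 m1"
      "t1 \<le> n * ((n + 2) ^ 1000 + 31) + 6" "holds_input G n k m1" "peeled G n n (m1 ''pos'')"
    using runs_peel[OF G V holds_input_pgc_input, of k 0] by auto
  define d where "d = later_degree_max n ?E (m1 ''pos'')"
  \<comment> \<open>Only after the peeling is the out-degree \<open>d\<close>, and with it the time
    base of the search, determined.\<close>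
  define M where "M = step_bound n k d"
  have M: "n + 2 \<le> M" unfolding M_def by (rule step_bound_ge)
  interpret grundy_search M m1 n k ?E "m1 ''pos''" d
  proof unfold_locales
    show "modulus_bound (log_upto n n + 1) k d ^ (k * k) \<le> M"
      unfolding M_def by (rule step_bound_ge_power)
  qed (use 1(3) M k d_def in \<open>auto simp: holds_input_def\<close>)
  have "agrees m1" by (simp add: agrees_def)
  with evals_answer[of "(0, m1)"] world_le_refl obtain t2 m2
    where 2: "runs (answer 0) m1 t2 m2" "t2 \<le> M ^ 2000000" "m2 stk 0 =
      of_bool (\<exists>q<modulus_bound (log_upto n n) k d. \<exists>N<(q + 1) ^ (k * k).
        all_witnessed n k ?E (m1 ''pos'') (hash_color k (q + 1) N))"
    by (rule evalsE)
  have out: "m2 stk 0 = of_bool (has_partial_grundy_coloring G k)"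
    unfolding 2(3) d_def hash_search_correct[OF G V k peeled_all(1)[OF 1(4)]] ..
  define m3 where "m3 = m2(''out'' := (m2 ''out'')(0 := m2 stk 0))"
  have "runs (Store ''out'' (Const 0) (slot 0)) m2 4 m3"
    using runs_cong[OF runs.Store[of "''out''" "Const 0" "slot 0" m2], of 4] by (simp add: m3_def)
  from runs.Seq[OF 1(1) runs.Seq[OF 2(1) this]]
  have "runs grundy_program ?m (1 + t1 + (1 + t2 + 4)) m3" unfolding grundy_program_def .
  moreover have "m3 ''out'' 0 = (if has_partial_grundy_coloring G k then 1 else 0)"
    by (simp add: m3_def out)
  moreover have "1 + t1 + (1 + t2 + 4) \<le> M ^ time_exponent"
  proof -
    have "(n + 2) ^ 1000 \<le> M ^ 1000" by (rule power_mono[OF M]) simp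
    from combined_time[OF _ 1(2) this 2(2)] M show ?thesis unfolding time_exponent_def by simp
  qed
  ultimately show ?thesis
    using peeled_all(2)[OF 1(4)] unfolding M_def d_def by blast
qed

section \<open>From the time base to the claimed bound\<close>

lemma power_le_self_power_exp:
  fixes x :: real
  assumes "0 \<le> x" and "r > 0"
  shows "x ^ r \<le> real r ^ r * exp x"
proof -
  \<comment> \<open>Raising \<open>y \<le> exp y\<close> to the power \<open>r\<close> for
    \<open>y = x / r\<close> cancels \<open>r\<close> in the exponent.\<close>
  have "x / real r \<le> exp (x / real r)" using exp_ge_add_one_self[of "x / real r"] by linarith
  then have "(x / real r) ^ r \<le> exp (x / real r) ^ r" using assms by (intro power_mono) auto
  also have "\<dots> = exp x" using assms by (simp flip: exp_of_nat_mult)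
  finally show ?thesis using assms by (simp add: power_divide field_simps)
qed

text \<open>Besides powers of \<open>k\<close>, the base contains \<open>4 ^ r\<close>, the
  logarithm to the power \<open>r\<close> and \<open>(d + 1) ^ (2 * r)\<close>. Here
  \<open>r ^ r\<close> equals \<open>k ^ (2 * r)\<close>, which leads to \<open>k ^ (8 * r)\<close>;
  the constant 192 is the product of 4, 16 and 3.\<close>

lemma step_bound_le:
  assumes k: "k \<ge> 1" and d: "d \<le> \<delta>"
  shows "real (step_bound n k d) \<le>
    192 * 2 powr (8 * (real k ^ 2 * (real \<delta> + log 2 (real k)))) * real (max 1 n) ^ 3"
proof -
  define r where "r = k * k"
  define l where "l = log_upto n n + 1"
  define N where "N = real (max 1 n)"
  define s where "s = sample_bound k d"
  have r: "r > 0" and N: "N \<ge> 1" using k by (auto simp: r_def N_def)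
  have "s > 0" using k by (simp add: s_def sample_bound_def)
  then have "0 < l * (s * s)" by (simp add: l_def)
  moreover have "2 * (x + 1) \<le> 4 * x" if "0 < x" for x :: nat using that by simp
  ultimately have "modulus_bound l k d \<le> 4 * (l * (s * s))" unfolding modulus_bound_def s_def by blast
  then have "real (modulus_bound l k d) \<le> real (4 * (l * (s * s)))" by (simp only: of_nat_le_iff)
  also have "\<dots> = 4 * real l * real k ^ 4 * (real (d + 1) * real (d + 1))"
    by (simp add: s_def sample_bound_def power4_eq_xxxx algebra_simps)
  also have "\<dots> \<le> 4 * real l * real k ^ 4 * (2 ^ d * 2 ^ d)"
  proof -
    have "d + 1 \<le> 2 ^ d" using less_exp[of d] by linarith
    then have "real (d + 1) \<le> real (2 ^ d)" by (simp only: of_nat_le_iff)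
    then have "real (d + 1) \<le> 2 ^ d" by simp
    then show ?thesis by (intro mult_left_mono mult_mono) auto
  qed
  also have "(2::real) ^ d * 2 ^ d = 4 ^ d" by (simp flip: power_mult_distrib)
  finally have "real (modulus_bound l k d) ^ r \<le> (4 * real l * real k ^ 4 * 4 ^ d) ^ r"
    by (intro power_mono) auto
  also have "\<dots> = 4 ^ r * real l ^ r * (real k ^ 4) ^ r * (4 ^ d) ^ r"
    by (simp only: power_mult_distrib)
  also have "\<dots> \<le> (4 * real r ^ r) * (real r ^ r * (16 * N ^ 2)) * (real k ^ 4) ^ r * (4 ^ \<delta>) ^ r"
  proof (intro mult_mono)
    \<comment> \<open>For \<open>k \<ge> 2\<close> already \<open>r \<ge> 4\<close>; the factor 4
      pays for \<open>k = 1\<close>.\<close>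
    show "(4::real) ^ r \<le> 4 * real r ^ r"
    proof (cases "k = 1")
      case False
      then have "2 * 2 \<le> k * k" using k by (intro mult_mono) auto
      then have "4 \<le> r" by (simp add: r_def)
      then have "(4::real) ^ r \<le> real r ^ r" by (intro power_mono) auto
      also have "\<dots> \<le> 4 * real r ^ r" by simp
      finally show ?thesis .
    qed (simp add: r_def)
    have "real l ^ r \<le> real r ^ r * exp (real l)" using r by (intro power_le_self_power_exp) auto
    also have "\<dots> \<le> real r ^ r * (16 * N ^ 2)"
    proof (intro mult_left_mono)
      have "exp (real l) = exp 1 ^ l" by (simp flip: exp_of_nat_mult)
      \<comment> \<open>With base 4 the exponential is a square of \<open>2 ^ l\<close>, hence
        quadratic in \<open>N\<close>.\<close>
      also have "\<dots> \<le> 4 ^ l" using exp_le by (intro power_mono) auto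
      also have "\<dots> = 4 * (2 ^ log_upto n n) ^ 2"
        by (simp add: l_def power2_eq_square flip: power_mult_distrib)
      also have "\<dots> \<le> 4 * (2 * N) ^ 2"
      proof -
        have "real (2 ^ log_upto n n) \<le> real (2 * max 1 n)"
          by (simp only: of_nat_le_iff log_upto_upper)
        then have "(2 ^ log_upto n n :: real) \<le> 2 * N" by (simp add: N_def)
        then show ?thesis by (intro mult_left_mono power_mono) auto
      qed
      also have "\<dots> = 16 * N ^ 2" by (simp add: power2_eq_square)
      finally show "exp (real l) \<le> 16 * N ^ 2" .
    qed auto
    finally show "real l ^ r \<le> real r ^ r * (16 * N ^ 2)" .
    show "((4::real) ^ d) ^ r \<le> (4 ^ \<delta>) ^ r" using d by (intro power_mono power_increasing) auto
  qed auto
  also have "\<dots> = 64 * N ^ 2 * (real k ^ (8 * r) * 4 ^ (\<delta> * r))"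
  proof -
    have "real r ^ r = real k ^ (2 * r)" unfolding r_def by (simp add: power_mult power2_eq_square)
    then have "real r ^ r * real r ^ r * (real k ^ 4) ^ r = real k ^ (8 * r)"
      by (simp flip: power_mult power_add)
    then show ?thesis by (simp add: power_mult[symmetric] mult_ac)
  qed
  also have "\<dots> \<le> 64 * N ^ 2 * 2 powr (8 * (real k ^ 2 * (real \<delta> + log 2 (real k))))"
  proof (intro mult_left_mono)
    have "real k ^ (8 * r) = (2 powr log 2 (real k)) ^ (8 * r)" using k by simp
    also have "\<dots> = 2 powr (8 * (real k ^ 2 * log 2 (real k)))"
      by (simp add: powr_realpow[symmetric] powr_powr r_def power2_eq_square mult_ac)
    finally have 1: "real k ^ (8 * r) = 2 powr (8 * (real k ^ 2 * log 2 (real k)))" .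
    have "(4::real) ^ (\<delta> * r) = 2 ^ (2 * (\<delta> * r))" by (simp add: power_mult)
    \<comment> \<open>Enlarged so that \<open>\<delta>\<close> and \<open>log 2 k\<close> share the
      coefficient 8.\<close>
    also have "\<dots> \<le> 2 ^ (8 * (\<delta> * r))" by (intro power_increasing) auto
    also have "\<dots> = 2 powr (8 * (real k ^ 2 * real \<delta>))"
      by (simp add: powr_realpow[symmetric] r_def power2_eq_square mult_ac)
    finally have "real k ^ (8 * r) * 4 ^ (\<delta> * r) \<le>
        2 powr (8 * (real k ^ 2 * log 2 (real k))) * 2 powr (8 * (real k ^ 2 * real \<delta>))"
      unfolding 1 by (intro mult_left_mono) auto
    then show "real k ^ (8 * r) * 4 ^ (\<delta> * r) \<le> 2 powr (8 * (real k ^ 2 * (real \<delta> + log 2 (real k))))"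
      by (simp add: powr_add[symmetric] algebra_simps)
  qed auto
  finally have *: "real (modulus_bound l k d) ^ r \<le>
    64 * N ^ 2 * 2 powr (8 * (real k ^ 2 * (real \<delta> + log 2 (real k))))" .
  have "real (step_bound n k d) = real (n + 2) * real (modulus_bound l k d) ^ r"
    by (simp only: step_bound_def l_def r_def of_nat_mult of_nat_power)
  also have "\<dots> \<le> (3 * N) * (64 * N ^ 2 * 2 powr (8 * (real k ^ 2 * (real \<delta> + log 2 (real k)))))"
    using * N by (intro mult_mono) (auto simp: N_def)
  also have "\<dots> = 192 * 2 powr (8 * (real k ^ 2 * (real \<delta> + log 2 (real k)))) * N ^ 3"
    by (simp add: power2_eq_square power3_eq_cube mult_ac)
  finally show ?thesis unfolding N_def .
qed

theorem theorem21:
  shows "\<exists>(P :: program) (c :: nat).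
    \<forall>(n :: nat) (k :: nat) (G :: nat pair_pre_digraph).
      pair_graph G \<longrightarrow> pverts G = {0..<n} \<longrightarrow> k \<ge> 1 \<longrightarrow>
      (\<exists>t m. runs P (pgc_input G n k) t m \<and>
         m ''out'' 0 = (if has_partial_grundy_coloring G k then 1 else 0) \<and>
         real t \<le> real c
           * 2 powr (real c * (real k ^ 2 * (real (degeneracy G) + log 2 (real k))))
           * real (max 1 n) ^ c)"
proof -
  obtain J where J: "J = time_exponent" "J \<ge> 1" by (simp add: time_exponent_def)
  \<comment> \<open>One \<open>c\<close> has to dominate the factor \<open>192 ^ J\<close> and the
    exponents \<open>8 * J\<close> and \<open>3 * J\<close>; \<open>J < 2 ^ J\<close> makes
    \<open>192 ^ J\<close> large enough for all three.\<close>
  define c :: nat where "c = 192 ^ J"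
  have "J < 2 ^ J" by (rule less_exp)
  then have "8 * J \<le> 8 * 2 ^ J" by simp
  also have "\<dots> \<le> 96 ^ J * 2 ^ J" using J(2) self_le_power[of "96::nat" J] by (intro mult_right_mono) auto
  also have "\<dots> = c" by (simp add: c_def flip: power_mult_distrib)
  finally have c: "8 * J \<le> c" .
  show ?thesis
  proof (rule exI[of _ grundy_program], rule exI[of _ c], intro allI impI)
    fix n k :: nat and G :: "nat pair_pre_digraph"
    assume G: "pair_graph G" and V: "pverts G = {0..<n}" and k: "k \<ge> 1"
    from runs_grundy_program[OF this] obtain t m d where run: "runs grundy_program (pgc_input G n k) t m"
      and d: "d \<le> degeneracy G"
      and out: "m ''out'' 0 = (if has_partial_grundy_coloring G k then 1 else 0)"
      and t: "t \<le> step_bound n k d ^ J"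
      unfolding J(1) by blast
    let ?X = "real k ^ 2 * (real (degeneracy G) + log 2 (real k))"
    let ?N = "real (max 1 n)"
    have X: "0 \<le> ?X" using k by simp
    have "real t \<le> real (step_bound n k d) ^ J" using t by (metis of_nat_le_iff of_nat_power)
    also have "\<dots> \<le> (192 * 2 powr (8 * ?X) * ?N ^ 3) ^ J"
      by (intro power_mono step_bound_le k d) simp
    also have "\<dots> = 192 ^ J * (2 powr (8 * ?X)) ^ J * (?N ^ 3) ^ J" by (simp only: power_mult_distrib)
    also have "(192::real) ^ J = real c" unfolding c_def by (simp only: of_nat_power of_nat_numeral)
    also have "(2 powr (8 * ?X)) ^ J = 2 powr (real (8 * J) * ?X)"
      by (simp add: powr_realpow[symmetric] powr_powr algebra_simps)
    also have "(?N ^ 3) ^ J = ?N ^ (3 * J)" by (rule power_mult[symmetric])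
    also have "real c * 2 powr (real (8 * J) * ?X) * ?N ^ (3 * J) \<le> real c * 2 powr (real c * ?X) * ?N ^ c"
    proof (intro mult_mono)
      show "2 powr (real (8 * J) * ?X) \<le> 2 powr (real c * ?X)"
        using c X by (intro powr_mono mult_right_mono) (simp_all only: of_nat_le_iff)
      show "?N ^ (3 * J) \<le> ?N ^ c" using c by (intro power_increasing) auto
    qed auto
    finally show "\<exists>t m. runs grundy_program (pgc_input G n k) t m \<and>
         m ''out'' 0 = (if has_partial_grundy_coloring G k then 1 else 0) \<and>
         real t \<le> real c * 2 powr (real c * ?X) * ?N ^ c"
      using run out by blast
  qed
qed

end
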